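(* Let $n\ge 2$ and $d\ge 2$ be integers, and let $\Upsilon$ be the Choi state of an $n$-step process tensor (as defined in the context). Then $$\mathrm{I}\le 2n\ln d-\frac{1}{2^n-2}\,\mathrm{N}.$$
   Context: An $n$-step process tensor with system dimension $d$ is represented by its Choi state $\Upsilon$, a density operator on $\mathcal{H}_{\mathrm{i}_0}\otimes\mathcal{H}_{\mathrm{o}_1}\otimes\cdots\otimes\mathcal{H}_{\mathrm{i}_{n-1}}\otimes\mathcal{H}_{\mathrm{o}_n}$ (each factor of dimension $d$) satisfying: for all $1\le j\le n$, $\mathrm{tr}_{\mathrm{o}_j}[\Upsilon_{1:j}]=\Upsilon_{1:j-1}\otimes\mathbb{I}_{\mathrm{i}_{j-1}}/d$, where $\Upsilon_{1:j}$ is the partial trace of $\Upsilon$ over $\mathrm{i}_j,\mathrm{o}_{j+1},\dots,\mathrm{i}_{n-1},\mathrm{o}_n$ (with $\Upsilon_{1:n}=\Upsilon$, $\Upsilon_{1:0}=1$). Entropies are von Neumann with natural log; $S_{\mathrm{i}_{j-1}},S_{\mathrm{o}_j}$ are single-factor marginal entropies of $\Upsilon$, $S_j$ the entropy of its marginal on $\mathrm{i}_{j-1}\mathrm{o}_j$, $S_{1:n}=S(\Upsilon)$. Total correlations: $\mathrm{I}=\sum_{j=1}^n(S_{\mathrm{i}_{j-1}}+S_{\mathrm{o}_j})-S_{1:n}$ (the multipartite mutual information among all $2n$ factors); non-Markovian correlations: $\mathrm{N}=\sum_{j=1}^n S_j-S_{1:n}$. *)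

theory Defs
  imports Complex_Main "Jordan_Normal_Form.Schur_Decomposition" "Jordan_Normal_Form.Char_Poly"
begin

text \<open>A system of m tensor factors, each of dimension d, is indexed by
  0 .. d^m - 1 in mixed radix; factor k (0 \<le> k < m) is the k-th most
  significant digit, so the ordering of factors matches the ordering of the
  Kronecker product (factor 0 leftmost).\<close>

definition digit :: "nat \<Rightarrow> nat \<Rightarrow> nat \<Rightarrow> nat \<Rightarrow> nat" where
  "digit d m k i = (i div d ^ (m - 1 - k)) mod d"

definition index_of :: "nat \<Rightarrow> nat \<Rightarrow> (nat \<Rightarrow> nat) \<Rightarrow> nat" where
  "index_of d m f = (\<Sum>k<m. f k * d ^ (m - 1 - k))"

text \<open>Global index built from a local index a on the kept factors K (in
  increasing order) and a local index c on the traced factors {..<m} - K.\<close>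
definition glue :: "nat \<Rightarrow> nat \<Rightarrow> nat set \<Rightarrow> nat \<Rightarrow> nat \<Rightarrow> nat" where
  "glue d m K a c = index_of d m (\<lambda>k.
     if k \<in> K then digit d (card K) (card {k'\<in>K. k' < k}) a
     else digit d (m - card K) (card {k'\<in>{..<m} - K. k' < k}) c)"

text \<open>Reduced state (partial trace over all factors not in K) of an operator
  rho on m factors of dimension d.  K is assumed to be a subset of {..<m}.\<close>
definition marginal :: "nat \<Rightarrow> nat \<Rightarrow> nat set \<Rightarrow> complex mat \<Rightarrow> complex mat" where
  "marginal d m K rho = mat (d ^ card K) (d ^ card K)
     (\<lambda>(a, b). \<Sum>c<d ^ (m - card K). rho $$ (glue d m K a c, glue d m K b c))"

definition kron :: "complex mat \<Rightarrow> complex mat \<Rightarrow> complex mat" where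
  "kron A B = mat (dim_row A * dim_row B) (dim_col A * dim_col B)
     (\<lambda>(i, j). A $$ (i div dim_row B, j div dim_col B) * B $$ (i mod dim_row B, j mod dim_col B))"

definition mtrace :: "complex mat \<Rightarrow> complex" where
  "mtrace A = (\<Sum>i<dim_row A. A $$ (i, i))"

definition density_operator :: "nat \<Rightarrow> complex mat \<Rightarrow> bool" where
  "density_operator N rho \<longleftrightarrow> rho \<in> carrier_mat N N \<and> mat_adjoint rho = rho \<and>
     (\<forall>v \<in> carrier_vec N. Re ((rho *\<^sub>v v) \<bullet>c v) \<ge> 0) \<and> mtrace rho = 1"

text \<open>Eigenvalues with algebraic multiplicity: the roots of the characteristic
  polynomial, listed with multiplicity (unique up to permutation).\<close>
definition eigenvalue_list :: "complex mat \<Rightarrow> complex list" where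
  "eigenvalue_list A = (SOME es. char_poly A = (\<Prod>a\<leftarrow>es. [:- a, 1:]))"

definition vn_entropy :: "complex mat \<Rightarrow> real" where
  "vn_entropy A = - (\<Sum>a\<leftarrow>eigenvalue_list A. Re a * ln (Re a))"

text \<open>Factors of an n-step process tensor: position 2(j-1) is i_{j-1},
  position 2j-1 is o_j (1 \<le> j \<le> n); 2n factors in total.\<close>

definition process_tensor :: "nat \<Rightarrow> nat \<Rightarrow> complex mat \<Rightarrow> bool" where
  "process_tensor n d Y \<longleftrightarrow> density_operator (d ^ (2 * n)) Y \<and>
     (\<forall>j \<in> {1..n}.
        marginal d (2 * j) {..< 2 * j - 1} (marginal d (2 * n) {..< 2 * j} Y)
        = kron (marginal d (2 * n) {..< 2 * j - 2} Y) ((1 / of_nat d) \<cdot>\<^sub>m 1\<^sub>m d))"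

definition total_corr :: "nat \<Rightarrow> nat \<Rightarrow> complex mat \<Rightarrow> real" where
  "total_corr n d Y = (\<Sum>j = 1..n. vn_entropy (marginal d (2 * n) {2 * j - 2} Y)
                                  + vn_entropy (marginal d (2 * n) {2 * j - 1} Y))
                      - vn_entropy Y"

definition nonmarkov_corr :: "nat \<Rightarrow> nat \<Rightarrow> complex mat \<Rightarrow> real" where
  "nonmarkov_corr n d Y = (\<Sum>j = 1..n. vn_entropy (marginal d (2 * n) {2 * j - 2, 2 * j - 1} Y))
                          - vn_entropy Y"

end

theory Submission
  imports Defs
begin

text \<open>Let \<open>s j\<close> be the entropy of the first \<open>j\<close> steps. All single-factor entropies are at most \<open>ln d\<close>, so
  \<open>I \<le> 2 n ln d - s n\<close>, and it remains to show \<open>N \<le> (2 ^ n - 2) s n\<close>. By the causality condition and the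
  Araki--Lieb inequality, \<open>s (j - 1) + ln d \<le> s j + S_{o_j}\<close>, so \<open>s\<close> is increasing. Araki--Lieb for the split
  of the first \<open>j\<close> steps into the past and step \<open>j\<close> gives \<open>S_j \<le> s (j - 1) + s j\<close>. Summing,
  \<open>N \<le> 2 (s 1 + ... + s (n - 1)) \<le> 2 (n - 1) s n\<close>, and \<open>2 (n - 1) \<le> 2 ^ n - 2\<close>.

  The Araki--Lieb inequality \<open>S(A) \<le> S(B) + S(AB)\<close> is obtained from a purification with purifying system
  \<open>C\<close>. Let \<open>r\<close> be the squared moduli of its coefficients in the eigenbases \<open>a\<close>, \<open>b\<close>, \<open>k\<close> of the reduced states
  on \<open>A\<close>, \<open>B\<close>, \<open>C\<close>, with eigenvalues \<open>al\<close>, \<open>be\<close>, \<open>p\<close>. The slices of the tensor at fixed \<open>a\<close> are orthogonal,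
  so Bessel's inequality bounds the sum of \<open>r k a b / al a\<close> over \<open>a\<close> by 1, and the claim is Gibbs' inequality
  for \<open>al a\<close> against \<open>be b * p k\<close> with weights \<open>r\<close>.\<close>

section \<open>Adjoints and the spectral theorem\<close>

lemma mat_adjoint_carrier [simp]:
  "A \<in> carrier_mat m n \<Longrightarrow> mat_adjoint A \<in> carrier_mat n m"
  by (auto simp: mat_adjoint_def)

lemma mat_adjoint_dim [simp]:
  "dim_row (mat_adjoint A) = dim_col A" "dim_col (mat_adjoint A) = dim_row A"
  by (auto simp: mat_adjoint_def)

lemma mat_adjoint_index [simp]:
  assumes "i < dim_col A" "j < dim_row A"
  shows "mat_adjoint A $$ (i, j) = conjugate (A $$ (j, i))"
  using assms by (simp add: mat_adjoint_def mat_of_rows_index)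

lemma mat_adjoint_mat_adjoint [simp]: "mat_adjoint (mat_adjoint A) = (A :: complex mat)"
  by (rule eq_matI) auto

lemma mat_adjoint_mult:
  fixes A B :: "complex mat"
  assumes "A \<in> carrier_mat n k" "B \<in> carrier_mat k m"
  shows "mat_adjoint (A * B) = mat_adjoint B * mat_adjoint A"
  by (rule eq_matI) (use assms in \<open>auto simp: scalar_prod_def mult.commute\<close>)

lemma mat_adjoint_four_block_mat:
  fixes A B C D :: "complex mat"
  assumes "A \<in> carrier_mat r1 c1" "B \<in> carrier_mat r1 c2" "C \<in> carrier_mat r2 c1" "D \<in> carrier_mat r2 c2"
  shows "mat_adjoint (four_block_mat A B C D)
       = four_block_mat (mat_adjoint A) (mat_adjoint C) (mat_adjoint B) (mat_adjoint D)"
  by (rule eq_matI) (use assms in auto)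

lemma mat_adjoint_one [simp]: "mat_adjoint (1\<^sub>m n :: complex mat) = 1\<^sub>m n"
  by (rule eq_matI) auto

lemma mat_adjoint_zero [simp]: "mat_adjoint (0\<^sub>m m n :: complex mat) = 0\<^sub>m n m"
  by (rule eq_matI) auto

text \<open>\<open>corthogonal\<close> means pairwise orthogonal and nonzero, so dividing each
  vector by its norm gives the columns of a unitary. The columns stay multiples of the given
  vectors, which keeps an eigenvector an eigenvector.\<close>

lemma unitary_of_corthogonal:
  fixes ws :: "complex vec list"
  assumes ws: "set ws \<subseteq> carrier_vec n" "corthogonal ws" "length ws = n"
  obtains W c where "W \<in> carrier_mat n n" "mat_adjoint W * W = 1\<^sub>m n"
    "\<And>j. j < n \<Longrightarrow> col W j = c j \<cdot>\<^sub>v ws ! j"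
proof -
  define r where "r j = (\<Sum>i<n. (cmod (ws ! j $ i))\<^sup>2)" for j
  define c where "c j = complex_of_real (1 / sqrt (r j))" for j
  define W where "W = mat n n (\<lambda>(i, j). c j * (ws ! j $ i))"
  have wsc: "ws ! j \<in> carrier_vec n" if "j < n" for j
    using ws that by auto
  have ip: "(ws ! i) \<bullet>c (ws ! j) = (\<Sum>k<n. ws ! i $ k * cnj (ws ! j $ k))" if "i < n" "j < n" for i j
    using wsc[OF that(1)] wsc[OF that(2)] by (auto simp: scalar_prod_def lessThan_atLeast0)
  have rr: "(ws ! j) \<bullet>c (ws ! j) = of_real (r j)" if "j < n" for j
    unfolding ip[OF that that] r_def of_real_sum complex_norm_square ..
  have rnz: "r j > 0" if "j < n" for j
  proof -
    have "(ws ! j) \<bullet>c (ws ! j) \<noteq> 0" using corthogonalD[OF ws(2), of j j] ws(3) that by simp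
    hence "r j \<noteq> 0" using rr that by auto
    moreover have "r j \<ge> 0" by (auto simp: r_def sum_nonneg)
    ultimately show ?thesis by simp
  qed
  have W: "W \<in> carrier_mat n n" by (simp add: W_def)
  have "mat_adjoint W * W = 1\<^sub>m n"
  proof (rule eq_matI)
    fix i j assume ij: "i < dim_row (1\<^sub>m n :: complex mat)" "j < dim_col (1\<^sub>m n :: complex mat)"
    hence ij: "i < n" "j < n" by auto
    have "(mat_adjoint W * W) $$ (i, j) = (\<Sum>k<n. cnj (c i * ws ! i $ k) * (c j * ws ! j $ k))"
      using ij W by (auto simp: scalar_prod_def W_def lessThan_atLeast0)
    also have "\<dots> = c i * c j * ((ws ! j) \<bullet>c (ws ! i))"
      by (simp add: ip ij sum_distrib_left c_def algebra_simps)
    also have "\<dots> = 1\<^sub>m n $$ (i, j)"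
    proof (cases "i = j")
      case True
      have "c j * c j * of_real (r j) = 1"
        using rnz[OF ij(2)] unfolding c_def of_real_mult[symmetric]
        by (simp add: real_sqrt_mult_self field_simps)
      with True ij show ?thesis by (simp add: rr)
    next
      case False
      with corthogonalD[OF ws(2), of j i] ws(3) ij show ?thesis by simp
    qed
    finally show "(mat_adjoint W * W) $$ (i, j) = 1\<^sub>m n $$ (i, j)" .
  qed (use W in auto)
  moreover have "col W j = c j \<cdot>\<^sub>v ws ! j" if "j < n" for j
    by (rule eq_vecI) (use that wsc[OF that] in \<open>auto simp: W_def\<close>)
  ultimately show ?thesis using W that by blast
qed

text \<open>Over the complex numbers the characteristic polynomial splits, so an eigenvector exists.
  Completed to a basis with it in front, Gram-Schmidt leaves this first vector untouched.\<close>

lemma unitary_first_col_eigenvector: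
  fixes A :: "complex mat"
  assumes A: "A \<in> carrier_mat n n" and n: "n \<noteq> 0"
  obtains W e where "W \<in> carrier_mat n n" "mat_adjoint W * W = 1\<^sub>m n"
    "A *\<^sub>v col W 0 = e \<cdot>\<^sub>v col W 0"
proof -
  obtain as where as: "char_poly A = (\<Prod>a\<leftarrow>as. [:- a, 1:])" "length as = n"
    using char_poly_factorized[OF A] by blast
  with n obtain e as' where "as = e # as'" by (cases as) auto
  hence "eigenvalue A e" using as by (simp add: eigenvalue_root_char_poly[OF A])
  then obtain v where v: "v \<in> carrier_vec n" "v \<noteq> 0\<^sub>v n" "A *\<^sub>v v = e \<cdot>\<^sub>v v"
    using A by (auto simp: eigenvalue_def eigenvector_def)
  interpret cof_vec_space n "TYPE(complex)" .
  define b where "b = basis_completion v"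
  from basis_completion[OF v(1,2), folded b_def]
  have dist_b: "distinct b" and indep: "\<not> lin_dep (set b)" and b: "set b \<subseteq> carrier_vec n"
    and hdb: "hd b = v" and len_b: "length b = n" by auto
  from hdb len_b n obtain vs where bv: "b = v # vs" by (cases b) auto
  define ws where "ws = gram_schmidt n b"
  from gram_schmidt_result[OF b dist_b indep refl, folded ws_def]
  have ws: "set ws \<subseteq> carrier_vec n" "corthogonal ws" "length ws = n"
    by (auto simp: len_b)
  have "hd ws = v" using gram_schmidt_hd[OF v(1), of vs, folded bv] by (simp add: ws_def)
  hence ws0: "ws ! 0 = v" using ws(3) n by (cases ws) auto
  obtain W c where W: "W \<in> carrier_mat n n" "mat_adjoint W * W = 1\<^sub>m n"
    "\<And>j. j < n \<Longrightarrow> col W j = c j \<cdot>\<^sub>v ws ! j"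
    using unitary_of_corthogonal[OF ws] by blast
  have "A *\<^sub>v col W 0 = e \<cdot>\<^sub>v col W 0"
    using W(3)[of 0] n ws0 v A by (simp add: mult_mat_vec smult_smult_assoc mult.commute)
  with W that show ?thesis by blast
qed

text \<open>Deflation: conjugating by a unitary whose first column is an eigenvector clears the rest
  of the first column, hence by hermiticity of the first row. The remaining block is Hermitian of
  size \<open>n\<close>, and the induction hypothesis diagonalises it.\<close>

theorem hermitian_spectral_theorem:
  fixes A :: "complex mat"
  assumes "A \<in> carrier_mat n n" "mat_adjoint A = A"
  shows "\<exists>U l. U \<in> carrier_mat n n \<and> mat_adjoint U * U = 1\<^sub>m n \<and>
           A = U * mat_diag n (\<lambda>a. complex_of_real (l a)) * mat_adjoint U"
  using assms
proof (induction n arbitrary: A)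
  case 0
  show ?case
    by (rule exI[of _ "1\<^sub>m 0"]) (use 0 in \<open>auto intro!: eq_matI\<close>)
next
  case (Suc n)
  note A = Suc.prems
  note sq = mult_carrier_mat[of _ "Suc n" "Suc n" _ "Suc n"] mat_adjoint_mult[of _ "Suc n" "Suc n" _ "Suc n"]
    assoc_mult_mat[of _ "Suc n" "Suc n" _ "Suc n" _ "Suc n"]
  obtain W e where W: "W \<in> carrier_mat (Suc n) (Suc n)" "mat_adjoint W * W = 1\<^sub>m (Suc n)"
    and ev: "A *\<^sub>v col W 0 = e \<cdot>\<^sub>v col W 0"
    using unitary_first_col_eigenvector[OF A(1)] by blast
  have WW: "W * mat_adjoint W = 1\<^sub>m (Suc n)"
    by (rule mat_mult_left_right_inverse[OF _ W(1) W(2)]) (use W in simp)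
  define A' where "A' = mat_adjoint W * (A * W)"
  have A'c: "A' \<in> carrier_mat (Suc n) (Suc n)" unfolding A'_def using A W by (auto intro!: mult_carrier_mat)
  have herm: "mat_adjoint A' = A'"
    unfolding A'_def using A W
    by (simp add: sq)
  have AA': "A = W * A' * mat_adjoint W"
  proof -
    have "W * A' * mat_adjoint W = (W * mat_adjoint W) * A * (W * mat_adjoint W)"
      unfolding A'_def using A W by (simp add: sq)
    thus ?thesis using A by (simp add: WW)
  qed
  have col0: "A' $$ (i, 0) = (if i = 0 then e else 0)" if "i < Suc n" for i
  proof -
    have "A' $$ (i, 0) = row (mat_adjoint W) i \<bullet> (A *\<^sub>v col W 0)"
      using that A W by (auto simp: A'_def mult_mat_vec_def)
    also have "\<dots> = e * (row (mat_adjoint W) i \<bullet> col W 0)"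
      using W that by (simp add: ev)
    also have "row (mat_adjoint W) i \<bullet> col W 0 = (mat_adjoint W * W) $$ (i, 0)"
      using W(1) that by simp
    finally show ?thesis using that by (simp add: W)
  qed
  have row0: "A' $$ (0, i) = (if i = 0 then e else 0)" if "i < Suc n" for i
  proof -
    have "A' $$ (0, i) = cnj (A' $$ (i, 0))"
      using arg_cong[OF herm, of "\<lambda>M. M $$ (0, i)"] A'c that by simp
    moreover have "cnj (A' $$ (0, 0)) = A' $$ (0, 0)"
      using arg_cong[OF herm, of "\<lambda>M. M $$ (0, 0)"] A'c that by simp
    ultimately show ?thesis using col0[of i] col0[of 0] that by auto
  qed
  \<comment> \<open>A diagonal entry of a Hermitian matrix is real, so \<open>Re e\<close> can serve
    as the new entry of the real spectrum.\<close>
  have e: "complex_of_real (Re e) = e"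
  proof -
    have "cnj (A' $$ (0, 0)) = A' $$ (0, 0)"
      using arg_cong[OF herm, of "\<lambda>M. M $$ (0, 0)"] A'c by simp
    thus ?thesis using col0[of 0] by (simp add: complex_eq_iff)
  qed
  define B where "B = mat n n (\<lambda>(i, j). A' $$ (Suc i, Suc j))"
  have B: "B \<in> carrier_mat n n" by (simp add: B_def)
  have "mat_adjoint B = B"
  proof (rule eq_matI)
    fix i j assume "i < dim_row B" "j < dim_col B"
    hence "i < n" "j < n" using B by auto
    thus "mat_adjoint B $$ (i, j) = B $$ (i, j)"
      using arg_cong[OF herm, of "\<lambda>M. M $$ (Suc i, Suc j)"] A'c by (simp add: B_def)
  qed (use B in auto)
  from Suc.IH[OF B this] obtain V l where V: "V \<in> carrier_mat n n" "mat_adjoint V * V = 1\<^sub>m n"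
    and BV: "B = V * mat_diag n (\<lambda>a. complex_of_real (l a)) * mat_adjoint V" by blast
  \<comment> \<open>\<open>F\<close> acts trivially on the deflated coordinate and by
    \<open>V\<close> on the rest; the diagonalising unitary of \<open>A\<close> will be
    \<open>W * F\<close>.\<close>
  define F where "F = four_block_mat (1\<^sub>m 1) (0\<^sub>m 1 n) (0\<^sub>m n 1) V"
  define D where "D = mat_diag n (\<lambda>a. complex_of_real (l a))"
  define E where "E = mat_diag 1 (\<lambda>_. e)"
  have c: "D \<in> carrier_mat n n" "E \<in> carrier_mat 1 1" by (auto simp: D_def E_def)
  have F: "F \<in> carrier_mat (Suc n) (Suc n)"
    unfolding F_def using V by (metis four_block_carrier_mat one_carrier_mat plus_1_eq_Suc)
  have adjF: "mat_adjoint F = four_block_mat (1\<^sub>m 1) (0\<^sub>m 1 n) (0\<^sub>m n 1) (mat_adjoint V)"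
    unfolding F_def by (subst mat_adjoint_four_block_mat[of _ 1 1 _ n _ n]) (use V in auto)
  have FF: "mat_adjoint F * F = 1\<^sub>m (Suc n)"
    unfolding adjF unfolding F_def
    by (subst mult_four_block_mat[of _ 1 1 _ n _ n _ _ 1 _ n]) (use V in auto)
  have A'4: "A' = four_block_mat E (0\<^sub>m 1 n) (0\<^sub>m n 1) B"
    by (rule eq_matI) (use A'c B in \<open>auto simp: row0 col0 B_def E_def mat_diag_def\<close>)
  have "F * mat_diag (Suc n) (\<lambda>a. complex_of_real (case_nat (Re e) l a)) * mat_adjoint F = A'"
  proof -
    have "mat_diag (Suc n) (\<lambda>a. complex_of_real (case_nat (Re e) l a))
        = four_block_mat E (0\<^sub>m 1 n) (0\<^sub>m n 1) D"
      by (rule eq_matI) (auto simp: E_def D_def mat_diag_def e split: nat.split)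
    moreover have "F * four_block_mat E (0\<^sub>m 1 n) (0\<^sub>m n 1) D = four_block_mat E (0\<^sub>m 1 n) (0\<^sub>m n 1) (V * D)"
      unfolding F_def
      by (subst mult_four_block_mat[of _ 1 1 _ n _ n _ _ 1 _ n]) (use V c in auto)
    moreover have "four_block_mat E (0\<^sub>m 1 n) (0\<^sub>m n 1) (V * D) * mat_adjoint F = A'"
      unfolding adjF A'4 BV D_def[symmetric]
      by (subst mult_four_block_mat[of _ 1 1 _ n _ n _ _ 1 _ n]) (use V c in auto)
    ultimately show ?thesis by simp
  qed
  note A'F = this
  define G where "G = mat_diag (Suc n) (\<lambda>a. complex_of_real (case_nat (Re e) l a))"
  have G: "G \<in> carrier_mat (Suc n) (Suc n)" by (simp add: G_def)
  have "mat_adjoint (W * F) * (W * F) = mat_adjoint F * (mat_adjoint W * W) * F"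
    using W(1) F
    by (simp add: sq)
  also have "\<dots> = 1\<^sub>m (Suc n)"
    using F by (simp add: W(2) right_mult_one_mat[of _ "Suc n" "Suc n"] FF)
  finally have 1: "mat_adjoint (W * F) * (W * F) = 1\<^sub>m (Suc n)" .
  have "A = (W * F) * G * mat_adjoint (W * F)"
    using W(1) F G unfolding AA' A'F[folded G_def, symmetric]
    by (simp add: sq)
  with 1 show ?case
    unfolding G_def using W(1) F by (intro exI[of _ "W * F"] exI[of _ "case_nat (Re e) l"]) auto
qed

section \<open>Entropy of a spectral decomposition\<close>

text \<open>Orthonormality of the columns and completeness are both recorded, since the index sums
  below are contracted over rows in some places and over columns in others.\<close>

definition unitary_on :: "nat \<Rightarrow> (nat \<Rightarrow> nat \<Rightarrow> complex) \<Rightarrow> bool" where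
  "unitary_on N U \<longleftrightarrow>
     (\<forall>a<N. \<forall>b<N. (\<Sum>i<N. cnj (U i a) * U i b) = of_bool (a = b)) \<and>
     (\<forall>i<N. \<forall>j<N. (\<Sum>a<N. U i a * cnj (U j a)) = of_bool (i = j))"

definition spectral_on :: "nat \<Rightarrow> complex mat \<Rightarrow> (nat \<Rightarrow> nat \<Rightarrow> complex) \<Rightarrow> (nat \<Rightarrow> real) \<Rightarrow> bool" where
  "spectral_on N A U l \<longleftrightarrow> A \<in> carrier_mat N N \<and> unitary_on N U \<and>
     (\<forall>i<N. \<forall>j<N. A $$ (i, j) = (\<Sum>a<N. of_real (l a) * U i a * cnj (U j a)))"

definition shannon :: "nat \<Rightarrow> (nat \<Rightarrow> real) \<Rightarrow> real" where
  "shannon N p = - (\<Sum>a<N. p a * ln (p a))"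

text \<open>Completeness comes for free: a left inverse of a square matrix is also a right
  inverse.\<close>

lemma unitary_on_iff_mat:
  "unitary_on N U \<longleftrightarrow>
     mat_adjoint (mat N N (\<lambda>(i, j). U i j)) * mat N N (\<lambda>(i, j). U i j) = 1\<^sub>m N"
  (is "_ \<longleftrightarrow> mat_adjoint ?U * ?U = _")
proof -
  have *: "mat_adjoint ?U * ?U = 1\<^sub>m N \<longleftrightarrow> (\<forall>a<N. \<forall>b<N. (\<Sum>i<N. cnj (U i a) * U i b) = of_bool (a = b))"
    by (auto simp: mat_eq_iff scalar_prod_def lessThan_atLeast0)
  have **: "?U * mat_adjoint ?U = 1\<^sub>m N \<longleftrightarrow> (\<forall>i<N. \<forall>j<N. (\<Sum>a<N. U i a * cnj (U j a)) = of_bool (i = j))"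
    by (auto simp: mat_eq_iff scalar_prod_def lessThan_atLeast0)
  have "mat_adjoint ?U * ?U = 1\<^sub>m N \<Longrightarrow> ?U * mat_adjoint ?U = 1\<^sub>m N"
    by (rule mat_mult_left_right_inverse) auto
  thus ?thesis unfolding unitary_on_def using * ** by blast
qed

lemma unitary_onI:
  assumes "\<And>a b. a < N \<Longrightarrow> b < N \<Longrightarrow> (\<Sum>i<N. cnj (U i a) * U i b) = of_bool (a = b)"
  shows "unitary_on N U"
  unfolding unitary_on_iff_mat
  by (rule eq_matI) (use assms in \<open>auto simp: scalar_prod_def lessThan_atLeast0\<close>)

lemma spectral_on_iff_mat:
  assumes A: "A \<in> carrier_mat N N"
  shows "spectral_on N A U l \<longleftrightarrow> unitary_on N U \<and>
     A = mat N N (\<lambda>(i, j). U i j) * mat_diag N (\<lambda>a. of_real (l a)) * mat_adjoint (mat N N (\<lambda>(i, j). U i j))"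
  using A unfolding spectral_on_def
  by (subst mat_diag_mult_right[of _ N])
     (auto simp: mat_eq_iff scalar_prod_def lessThan_atLeast0 mult.commute mult.left_commute)

lemma hermitian_spectral_on:
  assumes A: "A \<in> carrier_mat N N" and h: "mat_adjoint A = A"
  obtains U l where "spectral_on N A U l"
proof -
  obtain U l where U: "U \<in> carrier_mat N N" "mat_adjoint U * U = 1\<^sub>m N"
    and AU: "A = U * mat_diag N (\<lambda>a. complex_of_real (l a)) * mat_adjoint U"
    using hermitian_spectral_theorem[OF A h] by blast
  have "mat N N (\<lambda>(i, j). U $$ (i, j)) = U" by (rule eq_matI) (use U in auto)
  hence "spectral_on N A (\<lambda>i j. U $$ (i, j)) l"
    unfolding spectral_on_iff_mat[OF A] unitary_on_iff_mat using U AU by (simp only: simp_thms)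
  thus ?thesis by (rule that)
qed

section \<open>Entropy as a function of the multiset of eigenvalues\<close>

lemma proots_linear_factors: "proots (\<Prod>a\<leftarrow>as. [:- a, 1 :: complex:]) = mset as"
proof (induction as)
  case (Cons a as)
  define q where "q = (\<Prod>a\<leftarrow>as. [:- a, 1 :: complex:])"
  have "q \<noteq> 0" by (auto simp: q_def prod_list_zero_iff)
  hence "proots ([:- a, 1:] * q) = proots [:- a, 1:] + proots q" by (intro proots_mult) auto
  moreover have "proots [:- a, 1:] = {#a#}"
    using proots_linear_factor[of a] by simp
  ultimately show ?case using Cons by (simp add: q_def del: mult_pCons_left)
qed auto

text \<open>\<open>eigenvalue_list\<close> is an arbitrary choice, determined only up to order.
  Similarity to the diagonal matrix fixes the characteristic polynomial and thereby the multiset of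
  its roots, and the entropy sum depends on this multiset alone.\<close>

lemma vn_entropy_eq_shannon:
  assumes "spectral_on N A U l"
  shows "vn_entropy A = shannon N l"
proof -
  have A: "A \<in> carrier_mat N N" using assms by (simp add: spectral_on_def)
  define V where "V = mat N N (\<lambda>(i, j). U i j)"
  define D where "D = mat_diag N (\<lambda>a. complex_of_real (l a))"
  have V: "V \<in> carrier_mat N N" and D: "D \<in> carrier_mat N N" by (auto simp: V_def D_def)
  have u: "mat_adjoint V * V = 1\<^sub>m N" and AV: "A = V * D * mat_adjoint V"
    using assms unfolding spectral_on_iff_mat[OF A] unitary_on_iff_mat V_def D_def by blast+
  have "V * mat_adjoint V = 1\<^sub>m N"
    by (rule mat_mult_left_right_inverse[OF _ _ u]) (use V in auto)
  hence "similar_mat_wit A D V (mat_adjoint V)"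
    by (rule similar_mat_witI[OF _ u AV A D V mat_adjoint_carrier[OF V]])
  hence "similar_mat A D" unfolding similar_mat_def by blast
  hence "char_poly A = char_poly D" by (rule char_poly_similar)
  also have "\<dots> = (\<Prod>a\<leftarrow>diag_mat D. [:- a, 1:])"
    by (rule char_poly_upper_triangular[OF D]) (auto simp: D_def mat_diag_def)
  also have "diag_mat D = map (\<lambda>a. complex_of_real (l a)) [0..<N]"
    by (auto simp: diag_mat_def D_def mat_diag_def)
  finally have cp: "char_poly A = (\<Prod>a\<leftarrow>map (\<lambda>a. complex_of_real (l a)) [0..<N]. [:- a, 1:])" .
  \<comment> \<open>The factorisation just found is the existence witness that makes the
    \<open>SOME\<close> in \<open>eigenvalue_list\<close> meaningful.\<close>
  hence "char_poly A = (\<Prod>a\<leftarrow>eigenvalue_list A. [:- a, 1:])"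
    unfolding eigenvalue_list_def by (rule someI)
  hence "mset (eigenvalue_list A) = proots (char_poly A)"
    by (simp only: proots_linear_factors)
  also have "\<dots> = mset (map (\<lambda>a. complex_of_real (l a)) [0..<N])"
    by (simp only: cp proots_linear_factors)
  finally have "mset (eigenvalue_list A) = mset (map (\<lambda>a. complex_of_real (l a)) [0..<N])" .
  hence "mset (map (\<lambda>a. Re a * ln (Re a)) (eigenvalue_list A))
       = mset (map (\<lambda>a. Re a * ln (Re a)) (map (\<lambda>a. complex_of_real (l a)) [0..<N]))"
    by (simp only: mset_map)
  hence "(\<Sum>a\<leftarrow>eigenvalue_list A. Re a * ln (Re a))
       = (\<Sum>a\<leftarrow>map (\<lambda>a. complex_of_real (l a)) [0..<N]. Re a * ln (Re a))"
    by (simp only: sum_mset_sum_list[symmetric])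
  also have "\<dots> = (\<Sum>a<N. l a * ln (l a))"
    by (simp add: comp_def interv_sum_list_conv_sum_set_nat lessThan_atLeast0)
  finally show ?thesis by (simp add: vn_entropy_def shannon_def)
qed

lemma spectral_on_eigenvector:
  assumes "spectral_on N A U l" "i < N" "b < N"
  shows "(\<Sum>j<N. A $$ (i, j) * U j b) = of_real (l b) * U i b"
proof -
  have "(\<Sum>j<N. A $$ (i, j) * U j b) = (\<Sum>j<N. \<Sum>a<N. of_real (l a) * U i a * (cnj (U j a) * U j b))"
    using assms by (simp add: spectral_on_def sum_distrib_right mult.assoc)
  also have "\<dots> = (\<Sum>a<N. of_real (l a) * U i a * (\<Sum>j<N. cnj (U j a) * U j b))"
    by (subst sum.swap) (simp add: sum_distrib_left)
  also have "\<dots> = (\<Sum>a<N. of_real (l a) * U i a * of_bool (a = b))"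
    using assms by (intro sum.cong) (auto simp: spectral_on_def unitary_on_def)
  also have "\<dots> = of_real (l b) * U i b"
    using assms by (simp add: of_bool_def if_distrib cong: if_cong)
  finally show ?thesis .
qed

text \<open>The case \<open>a = b\<close> tests positivity on eigenvectors; the general case yields
  the orthogonality of the rotated slices.\<close>

lemma spectral_on_sandwich:
  assumes "spectral_on N A U l" "a < N" "b < N"
  shows "(\<Sum>i<N. \<Sum>j<N. cnj (U i a) * A $$ (i, j) * U j b) = of_bool (a = b) * of_real (l a)"
proof -
  have "(\<Sum>i<N. \<Sum>j<N. cnj (U i a) * A $$ (i, j) * U j b) = (\<Sum>i<N. cnj (U i a) * (of_real (l b) * U i b))"
    using assms by (intro sum.cong) (auto simp: spectral_on_eigenvector[symmetric] sum_distrib_left mult.assoc)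
  also have "\<dots> = of_real (l b) * (\<Sum>i<N. cnj (U i a) * U i b)"
    by (simp add: sum_distrib_left mult_ac)
  finally show ?thesis using assms by (auto simp: spectral_on_def unitary_on_def)
qed

section \<open>Density operators in coordinates and their spectra\<close>

lemma density_operator_iff:
  "density_operator N R \<longleftrightarrow> R \<in> carrier_mat N N \<and> (\<forall>i<N. \<forall>j<N. R $$ (i, j) = cnj (R $$ (j, i))) \<and>
     (\<forall>v. 0 \<le> Re (\<Sum>i<N. \<Sum>j<N. cnj (v i) * R $$ (i, j) * v j)) \<and> (\<Sum>i<N. R $$ (i, i)) = 1"
proof (cases "R \<in> carrier_mat N N")
  case R: True
  have h: "mat_adjoint R = R \<longleftrightarrow> (\<forall>i<N. \<forall>j<N. R $$ (i, j) = cnj (R $$ (j, i)))"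
  proof
    assume *: "mat_adjoint R = R"
    show "\<forall>i<N. \<forall>j<N. R $$ (i, j) = cnj (R $$ (j, i))"
    proof (intro allI impI)
      fix i j assume "i < N" "j < N"
      thus "R $$ (i, j) = cnj (R $$ (j, i))"
        using R arg_cong[OF *, of "\<lambda>M. M $$ (i, j)"] by simp
    qed
  next
    assume *: "\<forall>i<N. \<forall>j<N. R $$ (i, j) = cnj (R $$ (j, i))"
    show "mat_adjoint R = R"
    proof (rule eq_matI)
      fix i j assume "i < dim_row R" "j < dim_col R"
      with R have ij: "i < N" "j < N" by auto
      hence "R $$ (i, j) = cnj (R $$ (j, i))" using * by blast
      thus "mat_adjoint R $$ (i, j) = R $$ (i, j)" using ij R by simp
    qed (use R in auto)
  qed
  have q: "(R *\<^sub>v v) \<bullet>c v = (\<Sum>i<N. \<Sum>j<N. cnj (v $ i) * R $$ (i, j) * v $ j)"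
    if "v \<in> carrier_vec N" for v
    using R that by (auto simp: scalar_prod_def lessThan_atLeast0 sum_distrib_left sum_distrib_right mult_ac
        intro!: sum.cong)
  have p: "(\<forall>v\<in>carrier_vec N. Re ((R *\<^sub>v v) \<bullet>c v) \<ge> 0) \<longleftrightarrow>
      (\<forall>v. 0 \<le> Re (\<Sum>i<N. \<Sum>j<N. cnj (v i) * R $$ (i, j) * v j))"
  proof (intro iffI allI ballI)
    fix v :: "nat \<Rightarrow> complex"
    assume "\<forall>v\<in>carrier_vec N. Re ((R *\<^sub>v v) \<bullet>c v) \<ge> 0"
    hence "0 \<le> Re ((R *\<^sub>v vec N v) \<bullet>c vec N v)" by auto
    thus "0 \<le> Re (\<Sum>i<N. \<Sum>j<N. cnj (v i) * R $$ (i, j) * v j)"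
      by (subst (asm) q) auto
  next
    fix v :: "complex vec"
    assume "\<forall>v. 0 \<le> Re (\<Sum>i<N. \<Sum>j<N. cnj (v i) * R $$ (i, j) * v j)" "v \<in> carrier_vec N"
    thus "0 \<le> Re ((R *\<^sub>v v) \<bullet>c v)" by (subst q) auto
  qed
  have "mtrace R = (\<Sum>i<N. R $$ (i, i))" using R by (simp add: mtrace_def)
  thus ?thesis unfolding density_operator_def h p using R by (simp only: simp_thms)
qed (simp add: density_operator_def)

lemma density_operatorD:
  assumes "density_operator N R"
  shows "R \<in> carrier_mat N N" "\<And>i j. i < N \<Longrightarrow> j < N \<Longrightarrow> R $$ (i, j) = cnj (R $$ (j, i))"
    "\<And>v. 0 \<le> Re (\<Sum>i<N. \<Sum>j<N. cnj (v i) * R $$ (i, j) * v j)" "(\<Sum>i<N. R $$ (i, i)) = 1"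
proof -
  note * = assms[unfolded density_operator_iff]
  from * show "R \<in> carrier_mat N N" by (rule conjunct1)
  show "R $$ (i, j) = cnj (R $$ (j, i))" if "i < N" "j < N" for i j
    using *[THEN conjunct2, THEN conjunct1] that by blast
  show "0 \<le> Re (\<Sum>i<N. \<Sum>j<N. cnj (v i) * R $$ (i, j) * v j)" for v
    by (rule *[THEN conjunct2, THEN conjunct2, THEN conjunct1, THEN spec])
  from * show "(\<Sum>i<N. R $$ (i, i)) = 1" by (elim conjE)
qed

text \<open>Positivity tested on an eigenvector gives a nonnegative eigenvalue; since the
  eigenvectors are normalised, the trace is the sum of the eigenvalues.\<close>

lemma density_operator_spectral:
  assumes "density_operator N R"
  obtains U l where "spectral_on N R U l" "\<And>a. a < N \<Longrightarrow> 0 \<le> l a" "(\<Sum>a<N. l a) = 1"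
proof -
  obtain U l where s: "spectral_on N R U l"
    using assms hermitian_spectral_on[of R N] by (auto simp: density_operator_def)
  have nonneg: "0 \<le> l a" if "a < N" for a
  proof -
    have "0 \<le> Re (\<Sum>i<N. \<Sum>j<N. cnj (U i a) * R $$ (i, j) * U j a)"
      by (rule density_operatorD[OF assms])
    thus ?thesis by (simp add: spectral_on_sandwich[OF s that that])
  qed
  have "(\<Sum>i<N. R $$ (i, i)) = (\<Sum>i<N. \<Sum>a<N. of_real (l a) * (cnj (U i a) * U i a))"
    using s by (simp add: spectral_on_def mult_ac)
  also have "\<dots> = (\<Sum>a<N. of_real (l a) * (\<Sum>i<N. cnj (U i a) * U i a))"
    by (subst sum.swap) (simp add: sum_distrib_left)
  also have "\<dots> = (\<Sum>a<N. of_real (l a))"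
    using s by (intro sum.cong) (auto simp: spectral_on_def unitary_on_def)
  moreover have "(\<Sum>i<N. R $$ (i, i)) = 1"
    by (rule density_operatorD[OF assms])
  ultimately have "complex_of_real (\<Sum>a<N. l a) = 1" by simp
  hence "(\<Sum>a<N. l a) = 1" using of_real_eq_1_iff by blast
  with s nonneg that show ?thesis by blast
qed

section \<open>Elementary entropy bounds and Bessel's inequality\<close>

lemma shannon_nonneg:
  assumes "\<And>a. a < N \<Longrightarrow> 0 \<le> p a" "(\<Sum>a<N. p a) = 1"
  shows "0 \<le> shannon N p"
proof -
  have "p a * ln (p a) \<le> 0" if "a < N" for a
  proof -
    have "p a \<le> 1" using assms that member_le_sum[of a "{..<N}" p] by auto
    thus ?thesis using assms(1)[OF that] by (cases "p a = 0") (auto intro!: mult_nonneg_nonpos)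
  qed
  thus ?thesis by (auto simp: shannon_def intro!: sum_nonpos)
qed

text \<open>Gibbs' inequality against the uniform distribution.\<close>

lemma shannon_le_ln:
  assumes "\<And>a. a < N \<Longrightarrow> 0 \<le> p a" "(\<Sum>a<N. p a) = 1"
  shows "shannon N p \<le> ln (real N)"
proof -
  have N: "N > 0" using assms(2) by (cases N) auto
  \<comment> \<open>This is \<open>ln x \<le> x - 1\<close> at \<open>x = 1 / (N * p a)\<close>,
    multiplied by \<open>p a\<close>; a vanishing \<open>p a\<close> leaves only
    \<open>0 \<le> 1 / N\<close>.\<close>
  have "p a * (- ln (p a) - ln N) \<le> 1 / N - p a" if "a < N" for a
  proof (cases "p a = 0")
    case False
    hence "p a > 0" using assms(1)[OF that] by simp
    hence "- ln (p a) - ln N = ln (1 / (N * p a))"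
      using N by (simp add: ln_div ln_mult)
    also have "\<dots> \<le> 1 / (N * p a) - 1" using N \<open>p a > 0\<close> by (intro ln_le_minus_one) auto
    finally have "p a * (- ln (p a) - ln N) \<le> p a * (1 / (N * p a) - 1)"
      using \<open>p a > 0\<close> by (intro mult_left_mono) auto
    also have "p a * (1 / (N * p a) - 1) = 1 / N - p a"
      using \<open>p a > 0\<close> N by (simp add: field_simps)
    finally show ?thesis .
  qed (use N in auto)
  hence "(\<Sum>a<N. p a * (- ln (p a) - ln N)) \<le> (\<Sum>a<N. 1 / N - p a)" by (intro sum_mono) auto
  also have "\<dots> = 0" using assms N by (simp add: sum_subtractf)
  also have "(\<Sum>a<N. p a * (- ln (p a) - ln N)) = shannon N p - ln N"
  proof -
    have "(\<Sum>a<N. p a * (- ln (p a) - ln N)) = (\<Sum>a<N. - (p a * ln (p a)) - p a * ln N)"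
      by (intro sum.cong refl) (simp add: right_diff_distrib)
    also have "\<dots> = shannon N p - (\<Sum>a<N. p a) * ln N"
      by (simp add: shannon_def sum_subtractf sum_negf sum_distrib_right)
    finally show ?thesis by (simp add: assms)
  qed
  finally show ?thesis by simp
qed

lemma vn_entropy_nonneg: "density_operator N R \<Longrightarrow> 0 \<le> vn_entropy R"
  by (metis density_operator_spectral vn_entropy_eq_shannon shannon_nonneg)

lemma vn_entropy_le_ln: "density_operator N R \<Longrightarrow> vn_entropy R \<le> ln (real N)"
  by (metis density_operator_spectral vn_entropy_eq_shannon shannon_le_ln)

text \<open>The left-hand side is both the squared norm and the \<open>s0\<close> coordinate of the
  projection of the basis vector at \<open>s0\<close> onto the span of the \<open>w a\<close>. Hence
  its square is at most itself. If \<open>al a = 0\<close>, then \<open>w a\<close> vanishes on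
  \<open>S\<close> and its term is \<open>0 / 0 = 0\<close>.\<close>

lemma bessel_orthogonal:
  fixes w :: "nat \<Rightarrow> 's \<Rightarrow> complex" and al :: "nat \<Rightarrow> real"
  assumes S: "finite S" "s0 \<in> S"
    and orth: "\<And>a a'. a < P \<Longrightarrow> a' < P \<Longrightarrow> (\<Sum>s\<in>S. w a s * cnj (w a' s)) = of_bool (a = a') * of_real (al a)"
  shows "(\<Sum>a<P. (cmod (w a s0))\<^sup>2 / al a) \<le> 1"
proof -
  \<comment> \<open>These are the Fourier coefficients of the basis vector at \<open>s0\<close> in
    the orthogonal family \<open>w\<close>, so \<open>v\<close> below is its projection.\<close>
  define c where "c a = cnj (w a s0) / of_real (al a)" for a
  define v where "v s = (\<Sum>a<P. c a * w a s)" for s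
  define g where "g = (\<Sum>a<P. (cmod (w a s0))\<^sup>2 / al a)"
  have vs0: "v s0 = of_real g"
    unfolding v_def g_def c_def of_real_sum
    by (intro sum.cong refl) (simp only: of_real_divide complex_norm_square, simp)
  have "(\<Sum>s\<in>S. v s * cnj (v s)) = (\<Sum>s\<in>S. \<Sum>a<P. \<Sum>a'<P. c a * cnj (c a') * (w a s * cnj (w a' s)))"
    by (simp add: v_def sum_product mult_ac)
  also have "\<dots> = (\<Sum>a<P. \<Sum>a'<P. c a * cnj (c a') * (\<Sum>s\<in>S. w a s * cnj (w a' s)))"
    unfolding sum_distrib_left by (subst sum.swap, intro sum.cong refl, rule sum.swap)
  also have "\<dots> = (\<Sum>a<P. \<Sum>a'<P. of_bool (a = a') * (c a * cnj (c a) * of_real (al a)))"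
    by (intro sum.cong refl) (auto simp: orth)
  also have "\<dots> = (\<Sum>a<P. c a * cnj (c a) * of_real (al a))"
    by (intro sum.cong refl) (simp add: of_bool_def if_distrib[of "\<lambda>x. x * _"] cong: if_cong)
  also have "\<dots> = of_real g"
    unfolding g_def c_def of_real_sum
    by (intro sum.cong refl) (simp only: of_real_divide complex_norm_square, simp)
  finally have "complex_of_real (\<Sum>s\<in>S. (cmod (v s))\<^sup>2) = of_real g"
    by (simp only: of_real_sum complex_norm_square)
  hence "g = (\<Sum>s\<in>S. (cmod (v s))\<^sup>2)" by (simp only: of_real_eq_iff)
  also have "\<dots> \<ge> (cmod (v s0))\<^sup>2" using S by (intro member_le_sum) auto
  finally have le: "g\<^sup>2 \<le> g" by (simp add: vs0)
  have "g \<le> 1"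
  proof (rule ccontr)
    assume "\<not> g \<le> 1"
    hence "g * 1 < g * g" by (intro mult_strict_left_mono) auto
    with le show False by (simp add: power2_eq_square)
  qed
  thus ?thesis by (simp add: g_def)
qed

section \<open>An entropy bound for tripartite pure states\<close>

text \<open>The squared moduli form a joint distribution with marginals \<open>al\<close>,
  \<open>be\<close>, \<open>p\<close>, but for a general joint distribution the inequality fails.
  The orthogonality of different slices makes it true and enters through Bessel's
  inequality.\<close>

lemma shannon_le_of_orthogonal_slices:
  fixes x :: "nat \<Rightarrow> nat \<Rightarrow> nat \<Rightarrow> complex"
  assumes orth: "\<And>a a'. a < P \<Longrightarrow> a' < P \<Longrightarrow>
      (\<Sum>k<K. \<Sum>b<Q. x k a b * cnj (x k a' b)) = of_bool (a = a') * of_real (al a)"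
    and be: "\<And>b. b < Q \<Longrightarrow> be b = (\<Sum>k<K. \<Sum>a<P. (cmod (x k a b))\<^sup>2)"
    and p: "\<And>k. k < K \<Longrightarrow> p k = (\<Sum>a<P. \<Sum>b<Q. (cmod (x k a b))\<^sup>2)"
    and one: "(\<Sum>k<K. p k) = 1"
  shows "shannon P al \<le> shannon Q be + shannon K p"
proof -
  define r where "r k a b = (cmod (x k a b))\<^sup>2" for k a b
  have r0: "r k a b \<ge> 0" for k a b by (simp add: r_def)
  have al: "al a = (\<Sum>k<K. \<Sum>b<Q. r k a b)" if "a < P" for a
  proof -
    have "complex_of_real (al a) = of_real (\<Sum>k<K. \<Sum>b<Q. r k a b)"
      using orth[OF that that] by (simp only: r_def of_real_sum complex_norm_square) simp
    thus ?thesis by (simp only: of_real_eq_iff)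
  qed
  have be: "be b = (\<Sum>k<K. \<Sum>a<P. r k a b)" if "b < Q" for b using be[OF that] by (simp add: r_def)
  have p: "p k = (\<Sum>a<P. \<Sum>b<Q. r k a b)" if "k < K" for k using p[OF that] by (simp add: r_def)
  have beq: "(\<Sum>b<Q. be b) = 1"
  proof -
    have "(\<Sum>b<Q. be b) = (\<Sum>b<Q. \<Sum>k<K. \<Sum>a<P. r k a b)" by (simp add: be)
    also have "\<dots> = (\<Sum>k<K. \<Sum>b<Q. \<Sum>a<P. r k a b)" by (rule sum.swap)
    also have "\<dots> = (\<Sum>k<K. \<Sum>a<P. \<Sum>b<Q. r k a b)" by (intro sum.cong refl sum.swap)
    finally show ?thesis using one p by simp
  qed
  have r_al: "r k a b \<le> al a" if "k < K" "a < P" "b < Q" for k a b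
  proof -
    have "r k a b \<le> (\<Sum>b<Q. r k a b)" using that r0 by (intro member_le_sum) auto
    also have "\<dots> \<le> al a" unfolding al[OF that(2)]
      using that r0 by (intro member_le_sum[of k _ "\<lambda>k. \<Sum>b<Q. r k a b"] sum_nonneg) auto
    finally show ?thesis .
  qed
  have r_be: "r k a b \<le> be b" if "k < K" "a < P" "b < Q" for k a b
  proof -
    have "r k a b \<le> (\<Sum>a<P. r k a b)"
      using that r0 by (intro member_le_sum[of a _ "\<lambda>a. r k a b"]) auto
    also have "\<dots> \<le> be b" unfolding be[OF that(3)]
      using that r0 by (intro member_le_sum[of k _ "\<lambda>k. \<Sum>a<P. r k a b"] sum_nonneg) auto
    finally show ?thesis .
  qed
  have r_p: "r k a b \<le> p k" if "k < K" "a < P" "b < Q" for k a b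
  proof -
    have "r k a b \<le> (\<Sum>b<Q. r k a b)" using that r0 by (intro member_le_sum) auto
    also have "\<dots> \<le> p k" unfolding p[OF that(1)]
      using that r0 by (intro member_le_sum[of a _ "\<lambda>a. \<Sum>b<Q. r k a b"] sum_nonneg) auto
    finally show ?thesis .
  qed
  have p0: "p k \<ge> 0" if "k < K" for k using p[OF that] r0 by (simp add: sum_nonneg)
  have be0: "be b \<ge> 0" if "b < Q" for b using be[OF that] r0 by (simp add: sum_nonneg)
  \<comment> \<open>This is \<open>ln x \<le> x - 1\<close> at \<open>x = be b * p k / al a\<close>,
    weighted by \<open>r k a b\<close>. Each marginal dominates \<open>r k a b\<close>, so a
    positive weight makes all the logarithms legitimate; a zero weight makes both sides
    vanish.\<close>
  have gibbs: "r k a b - r k a b / al a * (be b * p k) \<le> r k a b * ln (al a) - r k a b * ln (be b) - r k a b * ln (p k)"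
    if "k < K" "a < P" "b < Q" for k a b
  proof (cases "r k a b = 0")
    case False
    hence r: "r k a b > 0" using r0[of k a b] by simp
    hence pos: "al a > 0" "be b > 0" "p k > 0"
      using r_al[OF that] r_be[OF that] r_p[OF that] by linarith+
    have "ln (be b) + ln (p k) - ln (al a) = ln (be b * p k / al a)"
      using pos by (simp add: ln_mult ln_div)
    also have "\<dots> \<le> be b * p k / al a - 1"
      using pos by (intro ln_le_minus_one) simp
    finally have "r k a b * (ln (be b) + ln (p k) - ln (al a)) \<le> r k a b * (be b * p k / al a - 1)"
      using r by (intro mult_left_mono) auto
    thus ?thesis by (simp add: algebra_simps)
  qed simp
  \<comment> \<open>The slices are regarded as vectors indexed by the pair \<open>(k, b)\<close>,
    and Bessel is applied at one fixed coordinate.\<close>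
  have bessel: "(\<Sum>a<P. r k a b / al a) \<le> 1" if "k < K" "b < Q" for k b
  proof -
    have "(\<Sum>a<P. (cmod ((\<lambda>a (k, b). x k a b) a (k, b)))\<^sup>2 / al a) \<le> 1"
      by (rule bessel_orthogonal[where S = "{..<K} \<times> {..<Q}"])
         (use that orth[unfolded sum.cartesian_product case_prod_unfold] in \<open>auto simp: case_prod_unfold\<close>)
    thus ?thesis by (simp add: r_def)
  qed
  \<comment> \<open>By Bessel the weights \<open>be b * p k * (\<Sum>a<P. r k a b / al a)\<close>
    have total mass at most 1. Writing 1 as the sum of all \<open>r k a b\<close> turns the
    difference into the summed left-hand sides of \<open>gibbs\<close>.\<close>
  have "0 \<le> 1 - (\<Sum>k<K. \<Sum>b<Q. be b * p k * (\<Sum>a<P. r k a b / al a))"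
  proof -
    have "(\<Sum>k<K. \<Sum>b<Q. be b * p k * (\<Sum>a<P. r k a b / al a)) \<le> (\<Sum>k<K. \<Sum>b<Q. be b * p k * 1)"
      using bessel be0 p0 by (intro sum_mono mult_left_mono) auto
    also have "\<dots> = (\<Sum>k<K. (\<Sum>b<Q. be b) * p k)" by (simp add: sum_distrib_right)
    finally show ?thesis by (simp add: beq one)
  qed
  also have "1 = (\<Sum>k<K. \<Sum>b<Q. \<Sum>a<P. r k a b)"
    using beq by (subst sum.swap) (simp add: be)
  also have "(\<Sum>k<K. \<Sum>b<Q. \<Sum>a<P. r k a b) - (\<Sum>k<K. \<Sum>b<Q. be b * p k * (\<Sum>a<P. r k a b / al a))
      = (\<Sum>k<K. \<Sum>b<Q. \<Sum>a<P. r k a b - r k a b / al a * (be b * p k))"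
    by (simp add: sum_subtractf sum_distrib_left mult.commute)
  also have "\<dots> \<le> (\<Sum>k<K. \<Sum>b<Q. \<Sum>a<P. r k a b * ln (al a) - r k a b * ln (be b) - r k a b * ln (p k))"
    using gibbs by (intro sum_mono) auto
  also have "\<dots> = (\<Sum>k<K. \<Sum>b<Q. \<Sum>a<P. r k a b * ln (al a)) - (\<Sum>k<K. \<Sum>b<Q. \<Sum>a<P. r k a b * ln (be b))
      - (\<Sum>k<K. \<Sum>b<Q. \<Sum>a<P. r k a b * ln (p k))"
    by (simp add: sum_subtractf)
  also have "(\<Sum>k<K. \<Sum>b<Q. \<Sum>a<P. r k a b * ln (al a)) = - shannon P al"
  proof -
    have "(\<Sum>k<K. \<Sum>b<Q. \<Sum>a<P. r k a b * ln (al a)) = (\<Sum>k<K. \<Sum>a<P. \<Sum>b<Q. r k a b * ln (al a))"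
      by (intro sum.cong refl sum.swap)
    also have "\<dots> = (\<Sum>a<P. \<Sum>k<K. \<Sum>b<Q. r k a b * ln (al a))" by (rule sum.swap)
    also have "\<dots> = (\<Sum>a<P. al a * ln (al a))"
      by (intro sum.cong refl) (simp add: sum_distrib_right[symmetric] al[symmetric])
    finally show ?thesis by (simp add: shannon_def)
  qed
  also have "(\<Sum>k<K. \<Sum>b<Q. \<Sum>a<P. r k a b * ln (be b)) = - shannon Q be"
  proof -
    have "(\<Sum>k<K. \<Sum>b<Q. \<Sum>a<P. r k a b * ln (be b)) = (\<Sum>b<Q. \<Sum>k<K. \<Sum>a<P. r k a b * ln (be b))" by (rule sum.swap)
    also have "\<dots> = (\<Sum>b<Q. be b * ln (be b))"
      by (intro sum.cong refl) (simp add: sum_distrib_right[symmetric] be[symmetric])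
    finally show ?thesis by (simp add: shannon_def)
  qed
  also have "(\<Sum>k<K. \<Sum>b<Q. \<Sum>a<P. r k a b * ln (p k)) = - shannon K p"
  proof -
    have "(\<Sum>k<K. \<Sum>b<Q. \<Sum>a<P. r k a b * ln (p k)) = (\<Sum>k<K. \<Sum>a<P. \<Sum>b<Q. r k a b * ln (p k))"
      by (intro sum.cong refl sum.swap)
    also have "\<dots> = (\<Sum>k<K. p k * ln (p k))"
      by (intro sum.cong refl) (simp add: sum_distrib_right[symmetric] p[symmetric])
    finally show ?thesis by (simp add: shannon_def)
  qed
  finally show ?thesis by simp
qed

section \<open>Changing the bases of subsystems\<close>

lemma sum_mult_cnj_expand:
  fixes f :: "nat \<Rightarrow> 's \<Rightarrow> complex"
  shows "(\<Sum>s\<in>S. (\<Sum>i<P. c i * f i s) * cnj (\<Sum>j<P. d j * f j s))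
       = (\<Sum>i<P. \<Sum>j<P. c i * (\<Sum>s\<in>S. f i s * cnj (f j s)) * cnj (d j))"
proof -
  have "(\<Sum>s\<in>S. (\<Sum>i<P. c i * f i s) * cnj (\<Sum>j<P. d j * f j s))
      = (\<Sum>s\<in>S. \<Sum>i<P. \<Sum>j<P. c i * (f i s * cnj (f j s)) * cnj (d j))"
    by (simp add: sum_product mult_ac)
  also have "\<dots> = (\<Sum>i<P. \<Sum>s\<in>S. \<Sum>j<P. c i * (f i s * cnj (f j s)) * cnj (d j))"
    by (rule sum.swap)
  also have "\<dots> = (\<Sum>i<P. \<Sum>j<P. \<Sum>s\<in>S. c i * (f i s * cnj (f j s)) * cnj (d j))"
    by (intro sum.cong refl sum.swap)
  finally show ?thesis by (simp add: sum_distrib_left sum_distrib_right)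
qed

text \<open>Completeness of \<open>W\<close> collapses the middle sum. Consequently a change of
  basis on a subsystem does not affect the result of tracing it out.\<close>

lemma unitary_on_parseval:
  assumes "unitary_on Q W"
  shows "(\<Sum>b<Q. (\<Sum>j<Q. cnj (W j b) * f j) * cnj (\<Sum>j<Q. cnj (W j b) * g j)) = (\<Sum>j<Q. f j * cnj (g j))"
proof -
  have "(\<Sum>b<Q. (\<Sum>j<Q. cnj (W j b) * f j) * cnj (\<Sum>j<Q. cnj (W j b) * g j))
      = (\<Sum>b<Q. (\<Sum>j<Q. f j * cnj (W j b)) * cnj (\<Sum>j<Q. g j * cnj (W j b)))"
    by (simp add: mult.commute)
  also have "\<dots> = (\<Sum>i<Q. \<Sum>j<Q. f i * (\<Sum>b<Q. cnj (W i b) * cnj (cnj (W j b))) * cnj (g j))"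
    by (rule sum_mult_cnj_expand)
  also have "\<dots> = (\<Sum>i<Q. \<Sum>j<Q. f i * of_bool (i = j) * cnj (g j))"
    using assms by (intro sum.cong refl) (auto simp: unitary_on_def mult.commute[of "cnj _"])
  also have "\<dots> = (\<Sum>i<Q. f i * cnj (g i))"
    by (intro sum.cong refl) (simp add: of_bool_def if_distrib if_distribR cong: if_cong)
  finally show ?thesis .
qed

text \<open>The rotation \<open>W\<close> acts on a system that is traced out and drops by Parseval;
  the rotation \<open>V\<close> conjugates \<open>RA\<close> into its eigenbasis, where it is
  diagonal.\<close>

lemma rotated_tensor_reduced:
  fixes y :: "nat \<Rightarrow> nat \<Rightarrow> nat \<Rightarrow> complex"
  assumes A: "spectral_on P RA V al" and W: "unitary_on Q W"
    and RA: "\<And>i i'. i < P \<Longrightarrow> i' < P \<Longrightarrow> RA $$ (i, i') = (\<Sum>k<K. \<Sum>j<Q. y k i j * cnj (y k i' j))"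
    and x: "\<And>k a b. x k a b = (\<Sum>j<Q. cnj (W j b) * (\<Sum>i<P. cnj (V i a) * y k i j))"
    and a: "a < P" "a' < P"
  shows "(\<Sum>k<K. \<Sum>b<Q. x k a b * cnj (x k a' b)) = of_bool (a = a') * of_real (al a)"
proof -
  have "(\<Sum>k<K. \<Sum>b<Q. x k a b * cnj (x k a' b))
      = (\<Sum>k<K. \<Sum>j<Q. (\<Sum>i<P. cnj (V i a) * y k i j) * cnj (\<Sum>i<P. cnj (V i a') * y k i j))"
    unfolding x by (intro sum.cong refl unitary_on_parseval[OF W])
  also have "\<dots> = (\<Sum>(k, j)\<in>{..<K} \<times> {..<Q}. (\<Sum>i<P. cnj (V i a) * y k i j) * cnj (\<Sum>i<P. cnj (V i a') * y k i j))"
    by (rule sum.cartesian_product)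
  also have "\<dots> = (\<Sum>i<P. \<Sum>i'<P. cnj (V i a) * (\<Sum>(k, j)\<in>{..<K} \<times> {..<Q}. y k i j * cnj (y k i' j)) * cnj (cnj (V i' a')))"
    using sum_mult_cnj_expand[of "\<lambda>i. cnj (V i a)" "\<lambda>i (k, j). y k i j" P "\<lambda>i. cnj (V i a')" "{..<K} \<times> {..<Q}"]
    by (simp add: case_prod_unfold)
  also have "\<dots> = (\<Sum>i<P. \<Sum>i'<P. cnj (V i a) * RA $$ (i, i') * V i' a')"
    by (intro sum.cong refl) (simp add: RA sum.cartesian_product)
  finally show ?thesis using spectral_on_sandwich[OF A a] by simp
qed

text \<open>Rotating the first two systems into eigenbases of \<open>RA\<close> and
  \<open>RB\<close> produces orthogonal slices. The index \<open>k\<close> is left alone, so its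
  weights \<open>p\<close> are preserved by Parseval.\<close>

lemma tripartite_pure_entropy_bound:
  fixes y :: "nat \<Rightarrow> nat \<Rightarrow> nat \<Rightarrow> complex"
  assumes A: "spectral_on P RA V al" and B: "spectral_on Q RB W be"
    and RA: "\<And>i i'. i < P \<Longrightarrow> i' < P \<Longrightarrow> RA $$ (i, i') = (\<Sum>k<K. \<Sum>j<Q. y k i j * cnj (y k i' j))"
    and RB: "\<And>j j'. j < Q \<Longrightarrow> j' < Q \<Longrightarrow> RB $$ (j, j') = (\<Sum>k<K. \<Sum>i<P. y k i j * cnj (y k i j'))"
    and p: "\<And>k. k < K \<Longrightarrow> of_real (p k) = (\<Sum>i<P. \<Sum>j<Q. y k i j * cnj (y k i j))"
    and one: "(\<Sum>k<K. p k) = 1"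
  shows "shannon P al \<le> shannon Q be + shannon K p"
proof -
  define x where "x k a b = (\<Sum>j<Q. cnj (W j b) * (\<Sum>i<P. cnj (V i a) * y k i j))" for k a b
  have V: "unitary_on P V" and W: "unitary_on Q W" using A B by (auto simp: spectral_on_def)
  \<comment> \<open>The two rotations commute; this form permits the same reduction with the two
    systems exchanged.\<close>
  have x': "x k a b = (\<Sum>i<P. cnj (V i a) * (\<Sum>j<Q. cnj (W j b) * y k i j))" for k a b
    unfolding x_def sum_distrib_left by (subst sum.swap) (simp add: mult_ac)
  show ?thesis
  proof (rule shannon_le_of_orthogonal_slices[OF _ _ _ one])
    fix a a' assume "a < P" "a' < P"
    thus "(\<Sum>k<K. \<Sum>b<Q. x k a b * cnj (x k a' b)) = of_bool (a = a') * of_real (al a)"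
      by (intro rotated_tensor_reduced[OF A W RA x_def]) auto
  next
    fix b assume b: "b < Q"
    have "(\<Sum>k<K. \<Sum>a<P. x k a b * cnj (x k a b)) = of_bool (b = b) * of_real (be b)"
      by (rule rotated_tensor_reduced[OF B V _ _ b b, where y = "\<lambda>k j i. y k i j" and x = "\<lambda>k b a. x k a b"])
         (auto simp: RB x')
    hence "complex_of_real (be b) = of_real (\<Sum>k<K. \<Sum>a<P. (cmod (x k a b))\<^sup>2)"
      by (simp only: of_real_sum complex_norm_square) simp
    thus "be b = (\<Sum>k<K. \<Sum>a<P. (cmod (x k a b))\<^sup>2)" by (simp only: of_real_eq_iff)
  next
    fix k assume k: "k < K"
    have "(\<Sum>a<P. \<Sum>b<Q. x k a b * cnj (x k a b))
        = (\<Sum>a<P. \<Sum>j<Q. (\<Sum>i<P. cnj (V i a) * y k i j) * cnj (\<Sum>i<P. cnj (V i a) * y k i j))"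
      unfolding x_def by (intro sum.cong refl unitary_on_parseval[OF W])
    also have "\<dots> = (\<Sum>j<Q. \<Sum>a<P. (\<Sum>i<P. cnj (V i a) * y k i j) * cnj (\<Sum>i<P. cnj (V i a) * y k i j))"
      by (rule sum.swap)
    also have "\<dots> = (\<Sum>j<Q. \<Sum>i<P. y k i j * cnj (y k i j))"
      by (intro sum.cong refl unitary_on_parseval[OF V])
    also have "\<dots> = (\<Sum>i<P. \<Sum>j<Q. y k i j * cnj (y k i j))" by (rule sum.swap)
    also have "\<dots> = of_real (p k)" by (rule p[OF k, symmetric])
    finally have "complex_of_real (p k) = of_real (\<Sum>a<P. \<Sum>b<Q. (cmod (x k a b))\<^sup>2)"
      by (simp only: of_real_sum complex_norm_square)
    thus "p k = (\<Sum>a<P. \<Sum>b<Q. (cmod (x k a b))\<^sup>2)" by (simp only: of_real_eq_iff)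
  qed
qed

section \<open>Partial traces and the Araki--Lieb inequality\<close>

text \<open>The pair \<open>(i, j)\<close> is encoded as \<open>i * Q + j\<close>, in agreement with
  the Kronecker order; the name tells which factor is traced out.\<close>

definition ptrace_right :: "nat \<Rightarrow> nat \<Rightarrow> complex mat \<Rightarrow> complex mat" where
  "ptrace_right P Q R = mat P P (\<lambda>(i, i'). \<Sum>j<Q. R $$ (i * Q + j, i' * Q + j))"

definition ptrace_left :: "nat \<Rightarrow> nat \<Rightarrow> complex mat \<Rightarrow> complex mat" where
  "ptrace_left P Q R = mat Q Q (\<lambda>(j, j'). \<Sum>i<P. R $$ (i * Q + j, i * Q + j'))"

lemma sum_lessThan_mult_split:
  fixes f :: "nat \<Rightarrow> 'a :: comm_monoid_add"
  shows "(\<Sum>s<P * Q. f s) = (\<Sum>i<P. \<Sum>j<Q. f (i * Q + j))"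
proof -
  have "(\<Sum>s<P * Q. f s) = (\<Sum>i<P. sum f {i * Q..<i * Q + Q})"
    by (rule sum.nat_group[symmetric])
  also have "\<dots> = (\<Sum>i<P. \<Sum>j<Q. f (i * Q + j))"
  proof (rule sum.cong[OF refl])
    fix i
    show "sum f {i * Q..<i * Q + Q} = (\<Sum>j<Q. f (i * Q + j))"
      using sum.shift_bounds_nat_ivl[of f 0 "i * Q" Q] by (simp add: lessThan_atLeast0 ac_simps)
  qed
  finally show ?thesis .
qed

lemma pair_index_less:
  fixes i j P Q :: nat
  assumes "i < P" "j < Q"
  shows "i * Q + j < P * Q"
proof -
  have "i * Q + j < Suc i * Q" using assms by simp
  also have "\<dots> \<le> P * Q" using assms by (intro mult_le_mono1) simp
  finally show ?thesis .
qed

text \<open>The quadratic form of a Gram matrix is a sum of squared moduli.\<close>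

lemma density_operator_gram:
  assumes "A \<in> carrier_mat N N"
    and A: "\<And>i j. i < N \<Longrightarrow> j < N \<Longrightarrow> A $$ (i, j) = (\<Sum>s\<in>S. f i s * cnj (f j s))"
    and tr: "(\<Sum>i<N. A $$ (i, i)) = 1"
  shows "density_operator N A"
  unfolding density_operator_iff
proof (intro conjI allI impI assms)
  fix i j assume "i < N" "j < N"
  thus "A $$ (i, j) = cnj (A $$ (j, i))" by (simp add: A mult.commute)
next
  fix v :: "nat \<Rightarrow> complex"
  have "(\<Sum>i<N. \<Sum>j<N. cnj (v i) * A $$ (i, j) * v j)
      = (\<Sum>i<N. \<Sum>j<N. cnj (v i) * (\<Sum>s\<in>S. f i s * cnj (f j s)) * cnj (cnj (v j)))"
    by (simp add: A)
  also have "\<dots> = (\<Sum>s\<in>S. (\<Sum>i<N. cnj (v i) * f i s) * cnj (\<Sum>j<N. cnj (v j) * f j s))"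
    by (rule sum_mult_cnj_expand[symmetric])
  also have "\<dots> = of_real (\<Sum>s\<in>S. (cmod (\<Sum>i<N. cnj (v i) * f i s))\<^sup>2)"
    by (simp only: of_real_sum complex_norm_square)
  finally have e: "(\<Sum>i<N. \<Sum>j<N. cnj (v i) * A $$ (i, j) * v j)
      = of_real (\<Sum>s\<in>S. (cmod (\<Sum>i<N. cnj (v i) * f i s))\<^sup>2)" .
  show "0 \<le> Re (\<Sum>i<N. \<Sum>j<N. cnj (v i) * A $$ (i, j) * v j)"
    unfolding e Re_complex_of_real by (intro sum_nonneg) simp
qed

text \<open>The index \<open>k\<close> of the purifying system runs over an eigenbasis of \<open>R\<close>.\<close>

lemma density_operator_purification:
  assumes "density_operator (P * Q) R"
  obtains y p where
    "\<And>i j i' j'. i < P \<Longrightarrow> j < Q \<Longrightarrow> i' < P \<Longrightarrow> j' < Q \<Longrightarrow>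
       R $$ (i * Q + j, i' * Q + j') = (\<Sum>k<P * Q. y k i j * cnj (y k i' j'))"
    "\<And>k. k < P * Q \<Longrightarrow> of_real (p k) = (\<Sum>i<P. \<Sum>j<Q. y k i j * cnj (y k i j))"
    "(\<Sum>k<P * Q. p k) = 1" "vn_entropy R = shannon (P * Q) p"
proof -
  obtain U p where s: "spectral_on (P * Q) R U p" and p: "\<And>a. a < P * Q \<Longrightarrow> 0 \<le> p a" "(\<Sum>a<P * Q. p a) = 1"
    using density_operator_spectral[OF assms] by blast
  define y where "y k i j = of_real (sqrt (p k)) * U (i * Q + j) k" for k i j
  have yy: "y k i j * cnj (y k i' j') = of_real (p k) * U (i * Q + j) k * cnj (U (i' * Q + j') k)"
    if "k < P * Q" for k i j i' j'
  proof -
    have "y k i j * cnj (y k i' j') = of_real (sqrt (p k) * sqrt (p k)) * U (i * Q + j) k * cnj (U (i' * Q + j') k)"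
      unfolding of_real_mult y_def by (simp add: mult_ac)
    thus ?thesis using p(1)[OF that] by simp
  qed
  show ?thesis
  proof (rule that[of y p])
    fix i j i' j' assume "i < P" "j < Q" "i' < P" "j' < Q"
    thus "R $$ (i * Q + j, i' * Q + j') = (\<Sum>k<P * Q. y k i j * cnj (y k i' j'))"
      using s pair_index_less[of _ P _ Q] by (simp add: yy spectral_on_def)
  next
    fix k assume k: "k < P * Q"
    have "(\<Sum>i<P. \<Sum>j<Q. y k i j * cnj (y k i j)) = (\<Sum>s<P * Q. of_real (p k) * (cnj (U s k) * U s k))"
      unfolding sum_lessThan_mult_split by (intro sum.cong refl) (simp add: yy k mult_ac)
    also have "\<dots> = of_real (p k) * (\<Sum>s<P * Q. cnj (U s k) * U s k)"
      by (simp add: sum_distrib_left)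
    finally show "of_real (p k) = (\<Sum>i<P. \<Sum>j<Q. y k i j * cnj (y k i j))"
      using s k by (simp add: spectral_on_def unitary_on_def)
  qed (use p vn_entropy_eq_shannon[OF s] in auto)
qed

lemma ptrace_index:
  assumes y: "\<And>i j i' j'. i < P \<Longrightarrow> j < Q \<Longrightarrow> i' < P \<Longrightarrow> j' < Q \<Longrightarrow>
       R $$ (i * Q + j, i' * Q + j') = (\<Sum>k<K. y k i j * cnj (y k i' j'))"
  shows "\<And>i i'. i < P \<Longrightarrow> i' < P \<Longrightarrow>
      ptrace_right P Q R $$ (i, i') = (\<Sum>k<K. \<Sum>j<Q. y k i j * cnj (y k i' j))"
    and "\<And>j j'. j < Q \<Longrightarrow> j' < Q \<Longrightarrow>
      ptrace_left P Q R $$ (j, j') = (\<Sum>k<K. \<Sum>i<P. y k i j * cnj (y k i j'))"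
proof -
  fix i i' assume "i < P" "i' < P"
  thus "ptrace_right P Q R $$ (i, i') = (\<Sum>k<K. \<Sum>j<Q. y k i j * cnj (y k i' j))"
    by (subst sum.swap) (simp add: ptrace_right_def y)
next
  fix j j' assume "j < Q" "j' < Q"
  thus "ptrace_left P Q R $$ (j, j') = (\<Sum>k<K. \<Sum>i<P. y k i j * cnj (y k i j'))"
    by (subst sum.swap) (simp add: ptrace_left_def y)
qed

text \<open>In terms of a purification, a partial trace is a Gram matrix whose inner index combines
  the purifying system with the traced factor.\<close>

lemma density_operator_ptrace:
  assumes R: "density_operator (P * Q) R"
  shows "density_operator P (ptrace_right P Q R)" "density_operator Q (ptrace_left P Q R)"
proof -
  obtain y p where y: "\<And>i j i' j'. i < P \<Longrightarrow> j < Q \<Longrightarrow> i' < P \<Longrightarrow> j' < Q \<Longrightarrow>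
       R $$ (i * Q + j, i' * Q + j') = (\<Sum>k<P * Q. y k i j * cnj (y k i' j'))"
    and "\<And>k. k < P * Q \<Longrightarrow> of_real (p k) = (\<Sum>i<P. \<Sum>j<Q. y k i j * cnj (y k i j))"
      "(\<Sum>k<P * Q. p k) = 1" "vn_entropy R = shannon (P * Q) p"
    by (rule density_operator_purification[OF R]) (rule that)
  have tr: "(\<Sum>i<P. \<Sum>j<Q. R $$ (i * Q + j, i * Q + j)) = 1"
    using density_operatorD(4)[OF R] unfolding sum_lessThan_mult_split .
  show "density_operator P (ptrace_right P Q R)"
  proof (rule density_operator_gram)
    fix i i' assume "i < P" "i' < P"
    thus "ptrace_right P Q R $$ (i, i')
        = (\<Sum>s\<in>{..<P * Q} \<times> {..<Q}. (\<lambda>i s. y (fst s) i (snd s)) i s * cnj ((\<lambda>i s. y (fst s) i (snd s)) i' s))"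
      by (simp add: ptrace_index[OF y] sum.cartesian_product case_prod_unfold)
  qed (use tr in \<open>auto simp: ptrace_right_def\<close>)
  show "density_operator Q (ptrace_left P Q R)"
  proof (rule density_operator_gram)
    fix j j' assume "j < Q" "j' < Q"
    thus "ptrace_left P Q R $$ (j, j')
        = (\<Sum>s\<in>{..<P * Q} \<times> {..<P}. (\<lambda>j s. y (fst s) (snd s) j) j s * cnj ((\<lambda>j s. y (fst s) (snd s) j) j' s))"
      by (simp add: ptrace_index[OF y] sum.cartesian_product case_prod_unfold)
  next
    have "(\<Sum>j<Q. ptrace_left P Q R $$ (j, j)) = (\<Sum>j<Q. \<Sum>i<P. R $$ (i * Q + j, i * Q + j))"
      by (simp add: ptrace_left_def)
    also have "\<dots> = (\<Sum>i<P. \<Sum>j<Q. R $$ (i * Q + j, i * Q + j))" by (rule sum.swap)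
    finally show "(\<Sum>j<Q. ptrace_left P Q R $$ (j, j)) = 1" by (simp add: tr)
  qed (auto simp: ptrace_left_def)
qed

text \<open>The purifying system carries the spectrum of \<open>R\<close>, so both inequalities are
  the tripartite bound, once for each order of the two factors.\<close>

theorem araki_lieb:
  assumes R: "density_operator (P * Q) R"
  shows "vn_entropy (ptrace_right P Q R) \<le> vn_entropy (ptrace_left P Q R) + vn_entropy R"
    and "vn_entropy (ptrace_left P Q R) \<le> vn_entropy (ptrace_right P Q R) + vn_entropy R"
proof -
  obtain y p where y: "\<And>i j i' j'. i < P \<Longrightarrow> j < Q \<Longrightarrow> i' < P \<Longrightarrow> j' < Q \<Longrightarrow>
       R $$ (i * Q + j, i' * Q + j') = (\<Sum>k<P * Q. y k i j * cnj (y k i' j'))"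
    and p: "\<And>k. k < P * Q \<Longrightarrow> of_real (p k) = (\<Sum>i<P. \<Sum>j<Q. y k i j * cnj (y k i j))"
    and one: "(\<Sum>k<P * Q. p k) = 1" and S: "vn_entropy R = shannon (P * Q) p"
    by (rule density_operator_purification[OF R]) (rule that)
  obtain V al where A: "spectral_on P (ptrace_right P Q R) V al"
    using density_operator_spectral[OF density_operator_ptrace(1)[OF R]] by blast
  obtain W be where B: "spectral_on Q (ptrace_left P Q R) W be"
    using density_operator_spectral[OF density_operator_ptrace(2)[OF R]] by blast
  note S = S vn_entropy_eq_shannon[OF A] vn_entropy_eq_shannon[OF B]
  have p': "of_real (p k) = (\<Sum>j<Q. \<Sum>i<P. y k i j * cnj (y k i j))" if "k < P * Q" for k
    unfolding p[OF that] by (rule sum.swap)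
  show "vn_entropy (ptrace_right P Q R) \<le> vn_entropy (ptrace_left P Q R) + vn_entropy R"
    unfolding S
    by (rule tripartite_pure_entropy_bound[OF A B ptrace_index[OF y] p one])
  show "vn_entropy (ptrace_left P Q R) \<le> vn_entropy (ptrace_right P Q R) + vn_entropy R"
    unfolding S
    by (rule tripartite_pure_entropy_bound[OF B A _ _ p' one])
       (simp_all add: ptrace_index[OF y])
qed

section \<open>Tensoring with a maximally mixed factor\<close>

lemma of_bool_eq_div_mod:
  fixes a b d :: nat
  shows "of_bool (a = b) = (of_bool (a div d = b div d) * of_bool (a mod d = b mod d) :: complex)"
proof -
  have "a = b \<longleftrightarrow> a div d = b div d \<and> a mod d = b mod d"
    by (metis div_mult_mod_eq)
  thus ?thesis by simp
qed

text \<open>The eigenvectors are products of an eigenvector of \<open>A\<close> and a standard basis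
  vector, the pair being encoded by quotient and remainder modulo \<open>d\<close>.\<close>

lemma spectral_on_kron_maximally_mixed:
  assumes A: "spectral_on P A U l" and d: "d > 0"
  shows "spectral_on (P * d) (kron A ((1 / of_nat d) \<cdot>\<^sub>m 1\<^sub>m d))
     (\<lambda>s t. U (s div d) (t div d) * of_bool (s mod d = t mod d)) (\<lambda>t. l (t div d) / real d)"
proof -
  have div: "s div d < P" if "s < P * d" for s using that by (simp add: less_mult_imp_div_less)
  have Ac: "dim_row A = P" "dim_col A = P" using A by (auto simp: spectral_on_def)
  have delta: "(\<Sum>j<d. of_bool (j = x) * of_bool (j = y)) = (of_bool (x = y) :: complex)" if "x < d" for x y
  proof -
    have "(\<Sum>j<d. of_bool (j = x) * of_bool (j = y)) = (\<Sum>j<d. if j = x then of_bool (x = y) else 0 :: complex)"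
      by (intro sum.cong) auto
    thus ?thesis using that by simp
  qed
  show ?thesis
    unfolding spectral_on_def
  proof (intro conjI allI impI unitary_onI)
    show "kron A ((1 / of_nat d) \<cdot>\<^sub>m 1\<^sub>m d) \<in> carrier_mat (P * d) (P * d)"
      by (simp add: kron_def Ac)
  next
    fix a b assume ab: "a < P * d" "b < P * d"
    have "(\<Sum>i<P * d. cnj (U (i div d) (a div d) * of_bool (i mod d = a mod d)) *
            (U (i div d) (b div d) * of_bool (i mod d = b mod d)))
        = (\<Sum>i<P. \<Sum>j<d. (cnj (U i (a div d)) * U i (b div d)) * (of_bool (j = a mod d) * of_bool (j = b mod d)))"
      unfolding sum_lessThan_mult_split using d by (intro sum.cong refl) (simp add: mult_ac)
    also have "\<dots> = (\<Sum>i<P. cnj (U i (a div d)) * U i (b div d)) * of_bool (a mod d = b mod d)"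
      using d by (simp add: sum_distrib_left[symmetric] sum_distrib_right delta)
    also have "\<dots> = of_bool (a = b)"
      using A div[OF ab(1)] div[OF ab(2)] of_bool_eq_div_mod[of a b d] by (simp add: spectral_on_def unitary_on_def)
    finally show "(\<Sum>i<P * d. cnj (U (i div d) (a div d) * of_bool (i mod d = a mod d)) *
            (U (i div d) (b div d) * of_bool (i mod d = b mod d))) = of_bool (a = b)" .
  next
    fix i j assume ij: "i < P * d" "j < P * d"
    have "(\<Sum>a<P * d. of_real (l (a div d) / real d) * (U (i div d) (a div d) * of_bool (i mod d = a mod d)) *
            cnj (U (j div d) (a div d) * of_bool (j mod d = a mod d)))
        = (\<Sum>a<P. \<Sum>c<d. (of_real (l a) * U (i div d) a * cnj (U (j div d) a)) / of_nat d *
            (of_bool (c = i mod d) * of_bool (c = j mod d)))"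
      unfolding sum_lessThan_mult_split using d by (intro sum.cong refl) auto
    also have "\<dots> = (\<Sum>a<P. (of_real (l a) * U (i div d) a * cnj (U (j div d) a)) / of_nat d * of_bool (i mod d = j mod d))"
      using d by (simp only: sum_distrib_left[symmetric]) (simp add: delta)
    also have "\<dots> = A $$ (i div d, j div d) * (of_bool (i mod d = j mod d) / of_nat d)"
      using A div[OF ij(1)] div[OF ij(2)] by (simp add: spectral_on_def sum_distrib_right sum_divide_distrib)
    also have "\<dots> = kron A ((1 / of_nat d) \<cdot>\<^sub>m 1\<^sub>m d) $$ (i, j)"
      using ij d by (simp add: kron_def Ac)
    finally show "kron A ((1 / of_nat d) \<cdot>\<^sub>m 1\<^sub>m d) $$ (i, j)
        = (\<Sum>a<P * d. of_real (l (a div d) / real d) * (U (i div d) (a div d) * of_bool (i mod d = a mod d)) *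
            cnj (U (j div d) (a div d) * of_bool (j mod d = a mod d)))" by simp
  qed
qed

text \<open>Each eigenvalue \<open>l a\<close> becomes \<open>d\<close> copies of
  \<open>l a / d\<close>; splitting the logarithm leaves \<open>ln d\<close> times the total mass
  1.\<close>

lemma vn_entropy_kron_maximally_mixed:
  assumes A: "density_operator P A" and d: "d > 0"
  shows "vn_entropy (kron A ((1 / of_nat d) \<cdot>\<^sub>m 1\<^sub>m d)) = vn_entropy A + ln (real d)"
proof -
  obtain U l where s: "spectral_on P A U l" and l: "\<And>a. a < P \<Longrightarrow> 0 \<le> l a" "(\<Sum>a<P. l a) = 1"
    using density_operator_spectral[OF A] by blast
  have "shannon (P * d) (\<lambda>t. l (t div d) / real d) = - (\<Sum>a<P. \<Sum>c<d. l a / d * ln (l a / d))"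
    unfolding shannon_def sum_lessThan_mult_split using d by simp
  also have "\<dots> = - (\<Sum>a<P. l a * ln (l a) - l a * ln d)"
  proof -
    have "(\<Sum>c<d. l a / d * ln (l a / d)) = l a * ln (l a) - l a * ln d" if "a < P" for a
      using l(1)[OF that] d by (cases "l a = 0") (auto simp: ln_div right_diff_distrib)
    thus ?thesis by simp
  qed
  also have "\<dots> = shannon P l + (\<Sum>a<P. l a) * ln d"
    by (simp add: shannon_def sum_subtractf sum_distrib_right)
  finally show ?thesis
    using vn_entropy_eq_shannon[OF s] vn_entropy_eq_shannon[OF spectral_on_kron_maximally_mixed[OF s d]] l by simp
qed

section \<open>Marginals on consecutive factors\<close>

text \<open>Digits are counted from the most significant end, so the induction strips the last
  factor: the other digits of \<open>i\<close> are those of \<open>i div d\<close>.\<close>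

lemma index_of_digit:
  assumes "i < d ^ m"
  shows "index_of d m (\<lambda>k. digit d m k i) = i"
  using assms
proof (induction m arbitrary: i)
  case (Suc m)
  have "i div d < d ^ m" using Suc.prems by (simp add: less_mult_imp_div_less mult.commute)
  have dg: "digit d (Suc m) k i = digit d m k (i div d)" and pw: "d ^ (m - k) = d ^ (m - 1 - k) * d" if "k < m" for k
  proof -
    have "m - k = Suc (m - 1 - k)" using that by simp
    thus "digit d (Suc m) k i = digit d m k (i div d)" "d ^ (m - k) = d ^ (m - 1 - k) * d"
      by (simp_all add: digit_def div_mult2_eq)
  qed
  have "index_of d (Suc m) (\<lambda>k. digit d (Suc m) k i)
      = (\<Sum>k<m. digit d (Suc m) k i * d ^ (m - k)) + digit d (Suc m) m i"
    by (simp add: index_of_def)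
  also have "(\<Sum>k<m. digit d (Suc m) k i * d ^ (m - k)) = index_of d m (\<lambda>k. digit d m k (i div d)) * d"
    unfolding index_of_def sum_distrib_right by (intro sum.cong refl) (simp add: dg pw)
  also have "index_of d m (\<lambda>k. digit d m k (i div d)) = i div d"
    by (rule Suc.IH) fact
  finally show ?case by (simp add: digit_def)
qed (simp add: index_of_def)

text \<open>Together with the next lemma this reads off the digits of \<open>x * d ^ e + y\<close>:
  low positions see only \<open>y\<close>, and for \<open>y < d ^ e\<close> high positions see only
  \<open>x\<close>.\<close>

lemma div_power_mod_add_multiple:
  fixes x y d e f :: nat
  assumes "f < e" "d > 0"
  shows "(x * d ^ e + y) div d ^ f mod d = y div d ^ f mod d"
proof -
  have "e = Suc (e - 1 - f) + f" using assms(1) by simp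
  hence "d ^ e = d ^ Suc (e - 1 - f) * d ^ f" by (metis power_add)
  hence "x * d ^ e + y = y + (x * d ^ (e - 1 - f) * d) * d ^ f" by simp
  hence "(x * d ^ e + y) div d ^ f = x * d ^ (e - 1 - f) * d + y div d ^ f"
    using assms(2) by (metis div_mult_self1 power_not_zero less_numeral_extra(3))
  thus ?thesis by simp
qed

lemma div_power_add_remainder:
  fixes x y d e f :: nat
  assumes "y < d ^ e" "e \<le> f" "d > 0"
  shows "(x * d ^ e + y) div d ^ f = x div d ^ (f - e)"
proof -
  have "d ^ f = d ^ e * d ^ (f - e)" using assms(2) by (simp flip: power_add)
  thus ?thesis using assms by (simp add: div_mult2_eq)
qed

text \<open>For a block of consecutive kept factors the traced index splits into a prefix
  \<open>c1\<close> and a suffix \<open>c2\<close>, and gluing inserts \<open>a\<close> between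
  them. The digits are compared separately before, inside and after the block.\<close>

lemma glue_block:
  assumes d: "d > 0" and m: "k + l \<le> m"
    and c1: "c1 < d ^ k" and a: "a < d ^ l" and c2: "c2 < d ^ (m - k - l)"
  shows "glue d m {k..<k + l} a (c1 * d ^ (m - k - l) + c2) = (c1 * d ^ l + a) * d ^ (m - k - l) + c2"
    (is "glue d m ?K a ?c = ?i")
proof -
  define r where "r = m - k - l"
  have mr: "m = k + l + r" using m by (simp add: r_def)
  have c2: "c2 < d ^ r" using c2 by (simp add: r_def)
  have ia: "c1 * d ^ l + a < d ^ (k + l)"
    using pair_index_less[OF c1 a] by (simp add: power_add)
  have i: "?i < d ^ m"
    using pair_index_less[OF ia c2] by (simp add: r_def[symmetric] mr power_add)
  have alr: "a * d ^ r + c2 < d ^ (l + r)"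
    using pair_index_less[OF a c2] by (simp add: power_add)
  have dig: "(if t \<in> ?K then digit d (card ?K) (card {t' \<in> ?K. t' < t}) a
      else digit d (m - card ?K) (card {t' \<in> {..<m} - ?K. t' < t}) ?c) = digit d m t ?i" if t: "t < m" for t
  proof -
    consider "t < k" | "k \<le> t" "t < k + l" | "k + l \<le> t" by linarith
    thus ?thesis
    proof cases
      case 1
      have "{t' \<in> {..<m} - ?K. t' < t} = {..<t}" using 1 t by auto
      hence "(if t \<in> ?K then digit d (card ?K) (card {t' \<in> ?K. t' < t}) a
          else digit d (m - card ?K) (card {t' \<in> {..<m} - ?K. t' < t}) ?c) = digit d (k + r) t (c1 * d ^ r + c2)"
        using 1 by (simp add: mr)
      also have "\<dots> = c1 div d ^ (k - 1 - t) mod d"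
        using div_power_add_remainder[OF c2 _ d, of "k + r - 1 - t" c1] 1 by (simp add: digit_def)
      also have "\<dots> = digit d m t (c1 * d ^ (l + r) + (a * d ^ r + c2))"
        using div_power_add_remainder[OF alr _ d, of "m - 1 - t" c1] 1 by (simp add: digit_def mr)
      also have "c1 * d ^ (l + r) + (a * d ^ r + c2) = ?i"
        by (simp add: mr power_add algebra_simps)
      finally show ?thesis .
    next
      case 2
      have "{t' \<in> ?K. t' < t} = {k..<t}" using 2 by auto
      hence "(if t \<in> ?K then digit d (card ?K) (card {t' \<in> ?K. t' < t}) a
          else digit d (m - card ?K) (card {t' \<in> {..<m} - ?K. t' < t}) ?c) = digit d l (t - k) a"
        using 2 by simp
      also have "\<dots> = (c1 * d ^ l + a) div d ^ (l - 1 - (t - k)) mod d"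
        using div_power_mod_add_multiple[OF _ d, of "l - 1 - (t - k)" l c1 a] 2 by (simp add: digit_def)
      also have "\<dots> = digit d m t ?i"
        using div_power_add_remainder[OF c2 _ d, of "m - 1 - t" "c1 * d ^ l + a"] 2
        by (simp add: digit_def mr add.commute[of l k])
      finally show ?thesis .
    next
      case 3
      \<comment> \<open>Past the block, the rank of \<open>t\<close> among the traced factors is
        \<open>t - l\<close>, because the \<open>l\<close> kept factors are skipped.\<close>
      have "{t' \<in> {..<m} - ?K. t' < t} = {..<t} - {k..<k + l}" using 3 t by auto
      moreover have "card ({..<t} - {k..<k + l}) = t - l"
        using 3 by (subst card_Diff_subset) auto
      ultimately have "(if t \<in> ?K then digit d (card ?K) (card {t' \<in> ?K. t' < t}) a
          else digit d (m - card ?K) (card {t' \<in> {..<m} - ?K. t' < t}) ?c) = digit d (k + r) (t - l) (c1 * d ^ r + c2)"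
        using 3 by (simp add: mr)
      also have "\<dots> = c2 div d ^ (m - 1 - t) mod d"
      proof -
        have "k + r - 1 - (t - l) = m - 1 - t" using 3 by (simp add: mr)
        thus ?thesis
          using div_power_mod_add_multiple[OF _ d, of "m - 1 - t" r c1 c2] 3 t by (simp add: digit_def mr)
      qed
      also have "\<dots> = digit d m t ?i"
        using div_power_mod_add_multiple[OF _ d, of "m - 1 - t" r "c1 * d ^ l + a" c2] 3 t by (simp add: digit_def mr)
      finally show ?thesis .
    qed
  qed
  have "glue d m ?K a ?c = index_of d m (\<lambda>t. digit d m t ?i)"
    unfolding glue_def index_of_def using dig by (intro sum.cong refl) auto
  thus ?thesis using index_of_digit[OF i] by simp
qed

text \<open>Reduces the digit-based \<open>marginal\<close> to nested two-factor partial traces, the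
  setting of the Araki-Lieb inequality: first the suffix is traced out, then the prefix.\<close>

lemma marginal_block:
  assumes d: "d > 0" and m: "k + l \<le> m"
  shows "marginal d m {k..<k + l} Y
    = ptrace_left (d ^ k) (d ^ l) (ptrace_right (d ^ (k + l)) (d ^ (m - k - l)) Y)"
proof (rule eq_matI)
  fix a b
  assume "a < dim_row (ptrace_left (d ^ k) (d ^ l) (ptrace_right (d ^ (k + l)) (d ^ (m - k - l)) Y))"
    "b < dim_col (ptrace_left (d ^ k) (d ^ l) (ptrace_right (d ^ (k + l)) (d ^ (m - k - l)) Y))"
  hence ab: "a < d ^ l" "b < d ^ l" by (auto simp: ptrace_left_def)
  have less: "c * d ^ l + x < d ^ (k + l)" if "c < d ^ k" "x < d ^ l" for c x
    using pair_index_less[OF that] by (simp add: power_add)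
  have "m - l = k + (m - k - l)" using m by simp
  hence e: "d ^ (m - l) = d ^ k * d ^ (m - k - l)" by (simp add: power_add)
  have "marginal d m {k..<k + l} Y $$ (a, b)
      = (\<Sum>c<d ^ k * d ^ (m - k - l). Y $$ (glue d m {k..<k + l} a c, glue d m {k..<k + l} b c))"
    using ab by (simp add: marginal_def e)
  also have "\<dots> = (\<Sum>c1<d ^ k. \<Sum>c2<d ^ (m - k - l).
      Y $$ ((c1 * d ^ l + a) * d ^ (m - k - l) + c2, (c1 * d ^ l + b) * d ^ (m - k - l) + c2))"
    unfolding sum_lessThan_mult_split
    using ab by (intro sum.cong refl) (simp only: lessThan_iff glue_block[OF d m])
  also have "\<dots> = ptrace_left (d ^ k) (d ^ l) (ptrace_right (d ^ (k + l)) (d ^ (m - k - l)) Y) $$ (a, b)"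
    using ab less by (simp add: ptrace_left_def ptrace_right_def)
  finally show "marginal d m {k..<k + l} Y $$ (a, b)
      = ptrace_left (d ^ k) (d ^ l) (ptrace_right (d ^ (k + l)) (d ^ (m - k - l)) Y) $$ (a, b)" .
qed (auto simp: marginal_def ptrace_left_def)

lemma ptrace_left_1: "R \<in> carrier_mat Q Q \<Longrightarrow> ptrace_left 1 Q R = R"
  by (rule eq_matI) (auto simp: ptrace_left_def)

lemma ptrace_right_1: "R \<in> carrier_mat P P \<Longrightarrow> ptrace_right P 1 R = R"
  by (rule eq_matI) (auto simp: ptrace_right_def)

lemma ptrace_right_ptrace_right:
  "ptrace_right P Q (ptrace_right (P * Q) T Y) = ptrace_right P (Q * T) Y"
proof (rule eq_matI)
  fix i j assume "i < dim_row (ptrace_right P (Q * T) Y)" "j < dim_col (ptrace_right P (Q * T) Y)"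
  hence ij: "i < P" "j < P" by (auto simp: ptrace_right_def)
  have "ptrace_right P (Q * T) Y $$ (i, j)
      = (\<Sum>s<Q. \<Sum>t<T. Y $$ (i * (Q * T) + (s * T + t), j * (Q * T) + (s * T + t)))"
    using ij unfolding ptrace_right_def sum_lessThan_mult_split by simp
  also have "\<dots> = ptrace_right P Q (ptrace_right (P * Q) T Y) $$ (i, j)"
    using ij by (simp add: ptrace_right_def pair_index_less add_mult_distrib mult.assoc add.assoc)
  finally show "ptrace_right P Q (ptrace_right (P * Q) T Y) $$ (i, j) = ptrace_right P (Q * T) Y $$ (i, j)" ..
qed (auto simp: ptrace_right_def)

lemma marginal_prefix:
  assumes "d > 0" "l \<le> m"
  shows "marginal d m {..<l} Y = ptrace_right (d ^ l) (d ^ (m - l)) Y"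
  using marginal_block[of d 0 l m Y] assms
  by (simp add: lessThan_atLeast0 ptrace_left_1[of _ "d ^ l", simplified] ptrace_right_def)

lemma marginal_full:
  assumes "d > 0" "Y \<in> carrier_mat (d ^ m) (d ^ m)"
  shows "marginal d m {..<m} Y = Y"
  using assms ptrace_right_1[OF assms(2)] by (simp add: marginal_prefix)

lemma density_operator_marginal_block:
  assumes d: "d > 0" and m: "k + l \<le> m" and Y: "density_operator (d ^ m) Y"
  shows "density_operator (d ^ l) (marginal d m {k..<k + l} Y)"
proof -
  have "density_operator (d ^ (k + l)) (ptrace_right (d ^ (k + l)) (d ^ (m - k - l)) Y)"
    using density_operator_ptrace(1)[of "d ^ (k + l)" "d ^ (m - k - l)" Y] Y m
    by (simp flip: power_add)
  thus ?thesis
    unfolding marginal_block[OF d m] by (intro density_operator_ptrace(2)) (simp add: power_add)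
qed

section \<open>Process tensors\<close>

context
  fixes n d :: nat and Y :: "complex mat"
  assumes d: "d > 0" and pt: "process_tensor n d Y"
begin

lemma process_tensor_density: "density_operator (d ^ (2 * n)) Y"
  using pt by (simp add: process_tensor_def)

lemma vn_entropy_marginal_le:
  assumes "k < 2 * n"
  shows "vn_entropy (marginal d (2 * n) {k} Y) \<le> ln (real d)"
proof -
  have "density_operator (d ^ 1) (marginal d (2 * n) {k..<k + 1} Y)"
    by (rule density_operator_marginal_block[OF d _ process_tensor_density]) (use assms in auto)
  moreover have "{k..<k + 1} = {k}" by auto
  ultimately show ?thesis using vn_entropy_le_ln by fastforce
qed

lemma density_operator_prefix:
  assumes "i \<le> n"
  shows "density_operator (d ^ (2 * i)) (marginal d (2 * n) {..<2 * i} Y)"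
  using density_operator_marginal_block[OF d _ process_tensor_density, of 0 "2 * i"] assms
  by (simp add: lessThan_atLeast0)

lemma prefix_reduce:
  assumes "i < n"
  shows "ptrace_right (d ^ (2 * i)) (d ^ 2) (marginal d (2 * n) {..<2 * Suc i} Y)
       = marginal d (2 * n) {..<2 * i} Y"
proof -
  have "ptrace_right (d ^ (2 * i)) (d ^ 2) (ptrace_right (d ^ (2 * i) * d ^ 2) (d ^ (2 * n - 2 * Suc i)) Y)
      = ptrace_right (d ^ (2 * i)) (d ^ 2 * d ^ (2 * n - 2 * Suc i)) Y"
    by (rule ptrace_right_ptrace_right)
  moreover have "2 + (2 * n - 2 * Suc i) = 2 * n - 2 * i" using assms by simp
  hence "d ^ 2 * d ^ (2 * n - 2 * Suc i) = d ^ (2 * n - 2 * i)" by (metis power_add)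
  moreover have "d ^ (2 * i) * d ^ 2 = d ^ (2 * Suc i)" by (simp add: power2_eq_square)
  ultimately show ?thesis using assms d by (simp add: marginal_prefix)
qed

text \<open>Araki-Lieb for the first \<open>i + 1\<close> steps, split into the first
  \<open>i\<close> steps and the two factors of the last one. Steps are counted from 0 here.\<close>

lemma vn_entropy_step_le:
  assumes "i < n"
  shows "vn_entropy (marginal d (2 * n) {2 * i, 2 * i + 1} Y)
    \<le> vn_entropy (marginal d (2 * n) {..<2 * i} Y) + vn_entropy (marginal d (2 * n) {..<2 * Suc i} Y)"
proof -
  have K: "{2 * i..<2 * i + 2} = {2 * i, 2 * i + 1}" by auto
  have "marginal d (2 * n) {2 * i..<2 * i + 2} Y
      = ptrace_left (d ^ (2 * i)) (d ^ 2) (marginal d (2 * n) {..<2 * Suc i} Y)"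
    using marginal_block[OF d, of "2 * i" 2 "2 * n" Y] marginal_prefix[OF d, of "2 * Suc i" "2 * n" Y] assms
    by simp
  moreover have "density_operator (d ^ (2 * i) * d ^ 2) (marginal d (2 * n) {..<2 * Suc i} Y)"
    using density_operator_prefix[of "Suc i"] assms by (simp add: power2_eq_square mult_ac)
  ultimately show ?thesis using araki_lieb(2) prefix_reduce[OF assms] unfolding K by metis
qed

text \<open>Causality makes the input at each step maximally mixed and uncorrelated with the past, so adding it
  gains \<open>ln d\<close>, while by Araki--Lieb the output can remove at most \<open>ln d\<close>.\<close>

lemma vn_entropy_prefix_mono:
  assumes "i < n"
  shows "vn_entropy (marginal d (2 * n) {..<2 * i} Y) \<le> vn_entropy (marginal d (2 * n) {..<2 * Suc i} Y)"
proof -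
  define R where "R = marginal d (2 * n) {..<2 * Suc i} Y"
  define A where "A = marginal d (2 * n) {..<2 * i} Y"
  \<comment> \<open>The split isolates the last output; the left factor is the past together with
    the last input.\<close>
  have R: "density_operator (d ^ (2 * i + 1) * d) R"
    using density_operator_prefix[of "Suc i"] assms by (simp add: R_def mult_ac)
  have A: "density_operator (d ^ (2 * i)) A"
    using density_operator_prefix[of i] assms by (simp add: A_def)
  \<comment> \<open>The causality condition at \<open>j = Suc i\<close>, where
    \<open>2 * j - 2\<close> is \<open>2 * i\<close>.\<close>
  have "marginal d (2 * Suc i) {..<2 * Suc i - 1} R = kron A ((1 / of_nat d) \<cdot>\<^sub>m 1\<^sub>m d)"
    using pt assms unfolding process_tensor_def R_def A_def by (auto dest!: bspec[of _ _ "Suc i"])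
  moreover have "marginal d (2 * Suc i) {..<2 * Suc i - 1} R = ptrace_right (d ^ (2 * i + 1)) d R"
    using marginal_prefix[OF d, of "2 * i + 1" "2 * Suc i" R] by simp
  ultimately have "vn_entropy (ptrace_right (d ^ (2 * i + 1)) d R) = vn_entropy A + ln (real d)"
    using vn_entropy_kron_maximally_mixed[OF A d] by metis
  moreover have "vn_entropy (ptrace_left (d ^ (2 * i + 1)) d R) \<le> ln (real d)"
    by (rule vn_entropy_le_ln[OF density_operator_ptrace(2)[OF R]])
  ultimately show ?thesis using araki_lieb(1)[OF R] by (simp add: R_def A_def)
qed

lemma vn_entropy_prefix_le:
  assumes "i \<le> n"
  shows "vn_entropy (marginal d (2 * n) {..<2 * i} Y) \<le> vn_entropy Y"
  using assms
proof (induction rule: inc_induct)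
  case base
  show ?case
    using marginal_full[OF d] process_tensor_density by (simp add: density_operator_def)
next
  case (step i)
  thus ?case using vn_entropy_prefix_mono[of i] by simp
qed

text \<open>Summing the step bounds counts each proper nonempty prefix twice and the full state
  once. The latter cancels against the entropy subtracted in \<open>nonmarkov_corr\<close>, and
  monotonicity bounds the \<open>n - 1\<close> remaining prefixes.\<close>

lemma nonmarkov_corr_le:
  assumes n: "n \<ge> 1"
  shows "nonmarkov_corr n d Y \<le> 2 * (real n - 1) * vn_entropy Y"
proof -
  define s where "s i = vn_entropy (marginal d (2 * n) {..<2 * i} Y)" for i
  \<comment> \<open>The empty prefix is a state in dimension \<open>d ^ 0 = 1\<close>, whose entropy
    is at most \<open>ln 1\<close>.\<close>
  have s0: "s 0 \<le> 0"
    using vn_entropy_le_ln[OF density_operator_prefix[of 0]] by (simp add: s_def)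
  have sn: "s n = vn_entropy Y"
    using marginal_full[OF d] process_tensor_density by (simp add: s_def density_operator_def)
  have "(\<Sum>j = 1..n. vn_entropy (marginal d (2 * n) {2 * j - 2, 2 * j - 1} Y))
      = (\<Sum>i<n. vn_entropy (marginal d (2 * n) {2 * i, 2 * i + 1} Y))"
    using sum.atLeast1_atMost_eq[of "\<lambda>j. vn_entropy (marginal d (2 * n) {2 * j - 2, 2 * j - 1} Y)" n]
    by simp
  also have "\<dots> \<le> (\<Sum>i<n. s i + s (Suc i))"
    by (intro sum_mono) (simp add: s_def vn_entropy_step_le[simplified])
  also have "\<dots> = (\<Sum>i<n. s i) + (\<Sum>i<n. s (Suc i))" by (rule sum.distrib)
  also have "(\<Sum>i<n. s (Suc i)) = (\<Sum>i<n. s i) + s n - s 0"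
    using sum.lessThan_Suc_shift[of s n] by simp
  also have "(\<Sum>i<n. s i) = s 0 + (\<Sum>i = 1..<n. s i)"
    using n by (simp add: lessThan_atLeast0 sum.atLeast_Suc_lessThan)
  also have "(s 0 + (\<Sum>i = 1..<n. s i)) + (s 0 + (\<Sum>i = 1..<n. s i) + s n - s 0)
      \<le> 2 * (\<Sum>i = 1..<n. s i) + s n"
    using s0 by simp
  also have "(\<Sum>i = 1..<n. s i) \<le> (\<Sum>i = 1..<n. vn_entropy Y)"
    by (intro sum_mono) (simp add: s_def vn_entropy_prefix_le)
  finally show ?thesis
    using n by (simp add: nonmarkov_corr_def sn of_nat_diff algebra_simps)
qed

lemma total_corr_le: "total_corr n d Y \<le> 2 * real n * ln (real d) - vn_entropy Y"
proof -
  have "(\<Sum>j = 1..n. vn_entropy (marginal d (2 * n) {2 * j - 2} Y) + vn_entropy (marginal d (2 * n) {2 * j - 1} Y))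
      \<le> (\<Sum>j = 1..n. ln (real d) + ln (real d))"
    by (intro sum_mono add_mono vn_entropy_marginal_le) auto
  thus ?thesis by (simp add: total_corr_def)
qed

end

section \<open>Comparison of constants and conclusion\<close>

lemma two_mult_le_two_power: "n \<ge> 1 \<Longrightarrow> 2 * real n \<le> 2 ^ n"
proof (induction n rule: nat_induct_at_least)
  case (Suc n)
  have "2 * real (Suc n) \<le> 2 * real n + 2 * real n" using Suc by simp
  thus ?case using Suc by simp
qed simp

theorem mainTheorem5:
  fixes n d :: nat and Y :: "complex mat"
  assumes "n \<ge> 2" and "d \<ge> 2" and "process_tensor n d Y"
  shows "total_corr n d Y \<le> 2 * real n * ln (real d) - nonmarkov_corr n d Y / (2 ^ n - 2)"
proof -
  have d: "d > 0" using assms by simp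
  have S: "0 \<le> vn_entropy Y"
    by (rule vn_entropy_nonneg[OF process_tensor_density[OF d assms(3)]])
  have "nonmarkov_corr n d Y \<le> 2 * (real n - 1) * vn_entropy Y"
    using nonmarkov_corr_le[OF d assms(3)] assms by simp
  \<comment> \<open>Nonnegativity of the entropy allows enlarging the constant
    \<open>2 * (n - 1)\<close>; the two constants agree at \<open>n = 2\<close>.\<close>
  also have "\<dots> \<le> (2 ^ n - 2) * vn_entropy Y"
    using two_mult_le_two_power[of n] assms S by (intro mult_right_mono) (auto simp: algebra_simps)
  finally have N: "nonmarkov_corr n d Y \<le> (2 ^ n - 2) * vn_entropy Y" .
  have "(2 :: real) ^ n - 2 > 0"
    using two_mult_le_two_power[of n] assms by simp
  with N have "nonmarkov_corr n d Y / (2 ^ n - 2) \<le> vn_entropy Y"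
    by (simp add: divide_le_eq mult.commute)
  thus ?thesis using total_corr_le[OF d assms(3)] by simp
qed

end
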